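(* Let $\mathbb{X}$ be a Banach space with a quasi-greedy basis. If for some $1<q<\infty$ the space $B_{q,0}=(\bigoplus_{n=1}^\infty\ell_q^n)_0$ is isomorphic to a complemented subspace of $\mathbb{X}$, then $\mathbb{X}$ has a quasi-greedy basis $\mathcal{B}$ with $L_m[\mathcal{B}]\approx\log m$ for $m\ge2$.
   Context: Banach spaces are real or complex and bases are Schauder bases. Let $\mathcal{B}=(\mathbf{x}_n)_{n=1}^\infty$ be a basis of $\mathbb{X}$ with coordinate functionals $(\mathbf{x}_n^* )_{n=1}^\infty$. For $A\subseteq\mathbb{N}$, the coordinate projection is $S_A[\mathcal{B}](f)=\sum_{n\in A}\mathbf{x}_n^*(f)\,\mathbf{x}_n$ (when well defined), and $\operatorname{supp}(f)=\{n:\mathbf{x}_n^*(f)\neq0\}$. The basis is quasi-greedy if $0<\inf_j\|\mathbf{x}_j\|\le\sup_j\|\mathbf{x}_j\|<\infty$ and there is a constant $C$ such that $\|f-S_A[\mathcal{B}](f)\|\le C\|f\|$ whenever $f\in\mathbb{X}$ and $A\subseteq\mathbb{N}$ satisfy $|\mathbf{x}_j^*(f)|\le|\mathbf{x}_k^*(f)|$ for all $j\in\mathbb{N}\setminus A$ and $k\in A$. The w-conditionality constants are $$L_m[\mathcal{B}]=\sup\left\{\frac{\|S_A[\mathcal{B}](f)\|}{\|f\|}: f\ne0,\ \max(\operatorname{supp}(f))\le m,\ A\subseteq\mathbb{N}\right\}.$$ $\ell_q^n$ is $\mathbb{F}^n$ ($\mathbb{F}$ the scalar field) with the $\ell_q$-norm,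 and $(\bigoplus_n\mathbb{X}_n)_0$ is the direct sum in the $c_0$-sense. For families of nonnegative reals, $\alpha_i\lesssim\beta_i$ means there is a constant $C$ with $\alpha_i\le C\beta_i$ for all $i$, and $\alpha_i\approx\beta_i$ means $\alpha_i\lesssim\beta_i$ and $\beta_i\lesssim\alpha_i$. *)

theory Defs
  imports "HOL-Analysis.Analysis"
begin

(* The scalar field F is a type 'k of sort {real_normed_field, euclidean_space}: a commutative
   finite-dimensional real division algebra with multiplicative norm. By Frobenius' theorem real and
   complex are, up to isometric isomorphism, the only such types, so a statement over 'k covers
   exactly the real and the complex case. The scalar multiplication of the Banach space is an
   explicit parameter, since the class banach only provides the real one. *)
locale banach_space_over = vector_space scal
  for scal :: "'k::{real_normed_field,euclidean_space} \<Rightarrow> 'a::banach \<Rightarrow> 'a" +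
  assumes scale_of_real: "scal (of_real r) x = r *\<^sub>R x"
    and norm_scale: "norm (scal c x) = norm c * norm x"

lemma banach_space_over_real:
  "banach_space_over (scaleR :: real \<Rightarrow> 'a::banach \<Rightarrow> 'a)"
  by unfold_locales (simp_all add: scaleR_add_right scaleR_add_left)

lemma banach_space_over_complex:
  "banach_space_over ((*) :: complex \<Rightarrow> complex \<Rightarrow> complex)"
  by unfold_locales (simp_all add: algebra_simps norm_mult scaleR_conv_of_real)

(* Bases are indexed from 0, so b n is the basis vector x_(n+1) of the usual indexing. *)
definition schauder_basis :: "('k::field \<Rightarrow> 'a::banach \<Rightarrow> 'a) \<Rightarrow> (nat \<Rightarrow> 'a) \<Rightarrow> bool" where
  "schauder_basis scal b \<longleftrightarrow> (\<forall>f. \<exists>!a. (\<lambda>n. scal (a n) (b n)) sums f)"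

definition coord ::
    "('k::field \<Rightarrow> 'a::banach \<Rightarrow> 'a) \<Rightarrow> (nat \<Rightarrow> 'a) \<Rightarrow> nat \<Rightarrow> 'a \<Rightarrow> 'k" where
  "coord scal b n f = (THE a. (\<lambda>k. scal (a k) (b k)) sums f) n"

definition supp :: "('k::field \<Rightarrow> 'a::banach \<Rightarrow> 'a) \<Rightarrow> (nat \<Rightarrow> 'a) \<Rightarrow> 'a \<Rightarrow> nat set" where
  "supp scal b f = {n. coord scal b n f \<noteq> 0}"

(* The series converges wherever the projection is used below: in the definition of L_m it is a
   finite sum, and in the quasi-greedy condition A is finite or contains the support of f, because
   the coordinates with respect to a seminormalized basis tend to 0. *)
definition coord_proj ::
    "('k::field \<Rightarrow> 'a::banach \<Rightarrow> 'a) \<Rightarrow> (nat \<Rightarrow> 'a) \<Rightarrow> nat set \<Rightarrow> 'a \<Rightarrow> 'a" where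
  "coord_proj scal b A f = (\<Sum>n. if n \<in> A then scal (coord scal b n f) (b n) else 0)"

definition quasi_greedy_basis ::
    "('k::real_normed_field \<Rightarrow> 'a::banach \<Rightarrow> 'a) \<Rightarrow> (nat \<Rightarrow> 'a) \<Rightarrow> bool" where
  "quasi_greedy_basis scal b \<longleftrightarrow>
     schauder_basis scal b \<and>
     0 < (INF j. norm (b j)) \<and> bdd_above (range (\<lambda>j. norm (b j))) \<and>
     (\<exists>C. \<forall>f A. (\<forall>j k. j \<notin> A \<longrightarrow> k \<in> A \<longrightarrow> norm (coord scal b j f) \<le> norm (coord scal b k f))
        \<longrightarrow> norm (f - coord_proj scal b A f) \<le> C * norm f)"

(* With indices starting at 0, max (supp f) \<le> m becomes supp f \<subseteq> {..<m}. The set of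
   quotients is nonempty for m \<ge> 1 and always bounded, as f ranges over a finite-dimensional
   space and only finitely many sets A \<inter> {..<m} matter; hence a real supremum. *)
definition w_cond_const ::
    "('k::field \<Rightarrow> 'a::banach \<Rightarrow> 'a) \<Rightarrow> (nat \<Rightarrow> 'a) \<Rightarrow> nat \<Rightarrow> real" where
  "w_cond_const scal b m =
     Sup {norm (coord_proj scal b A f) / norm f | f A. f \<noteq> 0 \<and> supp scal b f \<subseteq> {..<m}}"

definition dominated_on :: "'i set \<Rightarrow> ('i \<Rightarrow> real) \<Rightarrow> ('i \<Rightarrow> real) \<Rightarrow> bool" where
  "dominated_on I \<alpha> \<beta> \<longleftrightarrow> (\<exists>C. \<forall>i\<in>I. \<alpha> i \<le> C * \<beta> i)"

definition equivalent_on :: "'i set \<Rightarrow> ('i \<Rightarrow> real) \<Rightarrow> ('i \<Rightarrow> real) \<Rightarrow> bool" where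
  "equivalent_on I \<alpha> \<beta> \<longleftrightarrow> dominated_on I \<alpha> \<beta> \<and> dominated_on I \<beta> \<alpha>"

definition lq_norm :: "real \<Rightarrow> nat \<Rightarrow> (nat \<Rightarrow> 'k::real_normed_field) \<Rightarrow> real" where
  "lq_norm q n v = (\<Sum>i<n. norm (v i) powr q) powr (1 / q)"

(* x n is the component of x in l_q^n, with coordinates x n 0, ..., x n (n - 1) padded by zeros;
   the additional component x 0 lies in the zero space. *)
definition Bq0 :: "real \<Rightarrow> (nat \<Rightarrow> nat \<Rightarrow> 'k::real_normed_field) set" where
  "Bq0 q = {x. (\<forall>n i. n \<le> i \<longrightarrow> x n i = 0) \<and> (\<lambda>n. lq_norm q n (x n)) \<longlonglongrightarrow> 0}"

definition Bq0_norm :: "real \<Rightarrow> (nat \<Rightarrow> nat \<Rightarrow> 'k::real_normed_field) \<Rightarrow> real" where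
  "Bq0_norm q x = (SUP n. lq_norm q n (x n))"

definition complemented_subspace ::
    "('k::field \<Rightarrow> 'a::banach \<Rightarrow> 'a) \<Rightarrow> 'a set \<Rightarrow> bool" where
  "complemented_subspace scal Y \<longleftrightarrow>
     closed Y \<and> module.subspace scal Y \<and>
     (\<exists>P. bounded_linear P \<and> (\<forall>c x. P (scal c x) = scal c (P x)) \<and>
          range P = Y \<and> (\<forall>y\<in>Y. P y = y))"

definition Bq0_isomorphic ::
    "('k::real_normed_field \<Rightarrow> 'a::banach \<Rightarrow> 'a) \<Rightarrow> real \<Rightarrow> 'a set \<Rightarrow> bool" where
  "Bq0_isomorphic scal q Y \<longleftrightarrow>
     (\<exists>T :: (nat \<Rightarrow> nat \<Rightarrow> 'k) \<Rightarrow> 'a. bij_betw T (Bq0 q) Y \<and>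
        (\<forall>x\<in>Bq0 q. \<forall>y\<in>Bq0 q. T (\<lambda>n i. x n i + y n i) = T x + T y) \<and>
        (\<forall>c. \<forall>x\<in>Bq0 q. T (\<lambda>n i. c * x n i) = scal c (T x)) \<and>
        (\<exists>c>0. \<exists>C. \<forall>x\<in>Bq0 q. c * Bq0_norm q x \<le> norm (T x) \<and> norm (T x) \<le> C * Bq0_norm q x))"

end

theory Submission
  imports Defs "HOL-Library.Discrete_Functions"
begin

text \<open>
  Upper bound: split the coefficients of a vector into dyadic levels. On one level the basis is
  unconditional, and only about \<open>log m\<close> levels matter for a vector supported on \<open>m\<close> indices.

  Lower bound: \<open>B_{q,0}\<close> splits off a copy of the \<open>c_0\<close>-sum of the spaces \<open>l_q^{2^k}\<close> with a complement
  isomorphic to \<open>B_{q,0}\<close>, so the whole space \<open>X\<close> is isomorphic to the direct sum of \<open>X\<close> and this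
  \<open>c_0\<close>-sum. In each \<open>l_q^{2^k}\<close> the mean-zero part is complemented by the constants, and the
  constants of all blocks together span \<open>c_0\<close>. Giving the constants the summing basis of \<open>c_0\<close>
  instead of the unit vector basis yields, as in the construction of Dilworth, Kalton and
  Kutzarova, a quasi-greedy basis of the \<open>c_0\<close>-sum. The summing basis has conditionality
  constants of order \<open>n\<close>, and its first \<open>n\<close> vectors are spread over about \<open>2^n\<close> basis vectors. This
  basis is interleaved with the given quasi-greedy basis of \<open>X\<close>.
\<close>

section \<open>Conditionality of quasi-greedy bases\<close>

text \<open>Conditionality and quasi-greediness pull against each other. A partial sum over
  \<open>A\<close> in a summing-type system is governed by the sums of its coefficients over the
  levels, and an arbitrary \<open>A\<close> can pick out every second level. But a constant function
  of norm 1 on level \<open>l\<close> is spread over \<open>2 ^ l\<close> coordinates of size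
  \<open>1 / theta ^ l\<close>; as \<open>theta > 1\<close>, a threshold keeps such flat parts up to
  a critical level and drops them beyond it. So a greedy set acts on the constants almost like an
  initial segment, which the summing basis tolerates. The errors are geometric series with ratio
  \<open>theta\<close> below the critical level and \<open>1 / mu\<close> above it, where
  \<open>mu > 1\<close> comes from \<open>q > 1\<close>. The complement of \<open>B_{q,0}\<close> in
  the space is not known to have a basis, so the given basis cannot be replaced on a part of the
  space. It is kept whole, and room for the new system is made inside \<open>B_{q,0}\<close>.
  Interleaving at equal rates changes indices by a factor of about 2, which a logarithm does not
  notice.\<close>

text \<open>Layer-cake argument: subtracting the minimal weight removes at least one index, and the
  superlevel sets that remain are superlevel sets of the original weights.\<close>

lemma layer_cake_bound:
  fixes z :: "'i \<Rightarrow> 'a::real_normed_vector" and w :: "'i \<Rightarrow> real"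
  assumes "finite D" and "\<And>n. n \<in> D \<Longrightarrow> 0 \<le> w n \<and> w n \<le> M" and "0 \<le> M"
    and "\<And>c. norm (\<Sum>n | n \<in> D \<and> c < w n. z n) \<le> L"
  shows "norm (\<Sum>n\<in>D. w n *\<^sub>R z n) \<le> M * L"
  using assms
proof (induction D arbitrary: w M rule: finite_psubset_induct)
  case (psubset D)
  have L0: "0 \<le> L" using psubset.prems(3)[of 0] norm_ge_zero order_trans by blast
  show ?case
  proof (cases "D = {}")
    case True
    then show ?thesis using L0 psubset.prems(2) by simp
  next
    case False
    define m where "m = Min (w ` D)"
    define D' where "D' = {n \<in> D. m < w n}"
    have mle: "m \<le> w n" if "n \<in> D" for n
      using that psubset.hyps by (simp add: m_def)
    have "m \<in> w ` D" unfolding m_def by (rule Min_in) (use False psubset.hyps in auto)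
    then obtain n0 where n0: "n0 \<in> D" "w n0 = m" by auto
    have m0: "0 \<le> m" "m \<le> M" using psubset.prems(1)[OF n0(1)] n0(2) by auto
    have sub: "D' \<subset> D" using n0 by (auto simp: D'_def)
    have tail: "norm (\<Sum>n\<in>D'. (w n - m) *\<^sub>R z n) \<le> (M - m) * L"
    proof (rule psubset.IH[OF sub])
      show "0 \<le> w n - m \<and> w n - m \<le> M - m" if "n \<in> D'" for n
        using that psubset.prems(1)[of n] by (auto simp: D'_def)
      show "0 \<le> M - m" using m0 by simp
      show "norm (\<Sum>n | n \<in> D' \<and> c < w n - m. z n) \<le> L" for c
      proof -
        have "{n. n \<in> D' \<and> c < w n - m} = {n. n \<in> D \<and> max m (m + c) < w n}"
          by (auto simp: D'_def)
        then show ?thesis using psubset.prems(3)[of "max m (m + c)"] by simp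
      qed
    qed
    have head: "norm (\<Sum>n\<in>D. z n) \<le> L"
    proof -
      have "{n. n \<in> D \<and> m - 1 < w n} = D" using mle by force
      then show ?thesis using psubset.prems(3)[of "m - 1"] by simp
    qed
    have "(\<Sum>n\<in>D. w n *\<^sub>R z n) = m *\<^sub>R (\<Sum>n\<in>D. z n) + (\<Sum>n\<in>D'. (w n - m) *\<^sub>R z n)"
    proof -
      have "(\<Sum>n\<in>D'. (w n - m) *\<^sub>R z n) = (\<Sum>n\<in>D. (w n - m) *\<^sub>R z n)"
        by (rule sum.mono_neutral_left) (use psubset.hyps mle in \<open>force simp: D'_def\<close>)+
      then show ?thesis
        by (simp add: scaleR_sum_right sum.distrib[symmetric] algebra_simps)
    qed
    then have "norm (\<Sum>n\<in>D. w n *\<^sub>R z n)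
        \<le> norm (m *\<^sub>R sum z D) + norm (\<Sum>n\<in>D'. (w n - m) *\<^sub>R z n)"
      by (simp only: norm_triangle_ineq)
    also have "\<dots> \<le> m * L + (M - m) * L"
      using tail mult_left_mono[OF head m0(1)] m0 by simp
    finally show ?thesis by (simp add: algebra_simps)
  qed
qed

section \<open>Coordinates of Schauder and quasi-greedy bases\<close>

lemma coord_eqI:
  assumes "schauder_basis scal b" and "(\<lambda>n. scal (a n) (b n)) sums f"
  shows "coord scal b n f = a n"
proof -
  have "\<exists>!a. (\<lambda>k. scal (a k) (b k)) sums f" using assms(1) by (simp add: schauder_basis_def)
  then show ?thesis unfolding coord_def 
    using the1_equality[of "\<lambda>a. (\<lambda>k. scal (a k) (b k)) sums f", OF _ assms(2)] by simp
qed

lemma coord_sums: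
  assumes "schauder_basis scal b"
  shows "(\<lambda>n. scal (coord scal b n f) (b n)) sums f"
proof -
  have "\<exists>!a. (\<lambda>k. scal (a k) (b k)) sums f" using assms by (simp add: schauder_basis_def)
  then show ?thesis unfolding coord_def by (rule theI')
qed

lemma coord_proj_finite:
  assumes "finite A"
  shows "coord_proj scal b A f = (\<Sum>n\<in>A. scal (coord scal b n f) (b n))"
  unfolding coord_proj_def by (rule sums_unique[OF sums_If_finite_set[OF assms], symmetric])

context banach_space_over
begin

lemma coord_finite_sum:
  assumes "schauder_basis scal b" and "finite D"
  shows "coord scal b n (\<Sum>i\<in>D. scal (a i) (b i)) = (if n \<in> D then a n else 0)"
proof (rule coord_eqI[OF assms(1)])
  have "(\<lambda>n. if n \<in> D then scal (a n) (b n) else 0) sums (\<Sum>i\<in>D. scal (a i) (b i))"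
    by (rule sums_If_finite_set[OF assms(2)])
  moreover have "(\<lambda>n. scal (if n \<in> D then a n else 0) (b n)) = (\<lambda>n.
      if n \<in> D then scal (a n) (b n) else 0)"
    by auto
  ultimately show "(\<lambda>n. scal (if n \<in> D then a n else 0) (b n)) sums (\<Sum>i\<in>D. scal (a i) (b i))"
    by simp
qed

lemma coord_add:
  assumes "schauder_basis scal b"
  shows "coord scal b n (f + g) = coord scal b n f + coord scal b n g"
  by (rule coord_eqI[OF assms])
    (use sums_add[OF coord_sums[OF assms] coord_sums[OF assms]] in \<open>simp add: scale_left_distrib\<close>)

lemma bounded_linear_scal: "bounded_linear (scal c)"
proof (rule bounded_linear_intro[where K = "norm c"])
  show "scal c (r *\<^sub>R x) = r *\<^sub>R scal c x" for r x
    by (metis scale_of_real scale_scale mult.commute)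
qed (simp_all add: scale_right_distrib norm_scale)

lemma coord_scal:
  assumes "schauder_basis scal b"
  shows "coord scal b n (scal c f) = c * coord scal b n f"
  by (rule coord_eqI[OF assms])
    (use bounded_linear.sums[OF bounded_linear_scal coord_sums[OF assms]] in simp)

text \<open>Restricted to finite \<open>A\<close>, where the projection is a finite sum and no
  convergence has to be discussed.\<close>

definition finite_greedy_bound :: "(nat \<Rightarrow> 'a) \<Rightarrow> real \<Rightarrow> bool" where
  "finite_greedy_bound b C \<longleftrightarrow> (\<forall>f A. finite A \<longrightarrow>
     (\<forall>j k. j \<notin> A \<longrightarrow> k \<in> A \<longrightarrow> norm (coord scal b j f) \<le> norm (coord scal b k f)) \<longrightarrow>
     norm (f - (\<Sum>n\<in>A. scal (coord scal b n f) (b n))) \<le> C * norm f)"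

lemma finite_greedy_boundD:
  assumes "finite_greedy_bound b C" and "finite A"
    and "\<And>j k. j \<notin> A \<Longrightarrow> k \<in> A \<Longrightarrow> norm (coord scal b j f) \<le> norm (coord scal b k f)"
  shows "norm (f - (\<Sum>n\<in>A. scal (coord scal b n f) (b n))) \<le> C * norm f"
  using assms unfolding finite_greedy_bound_def by blast

lemma quasi_greedyD:
  assumes "quasi_greedy_basis scal b"
  obtains C \<delta> B where "0 < C" "0 < \<delta>" "schauder_basis scal b"
    "\<forall>j. \<delta> \<le> norm (b j) \<and> norm (b j) \<le> B"
    "finite_greedy_bound b C"
proof -
  from assms obtain C where C: "\<And>f A. (\<And>j k. j \<notin> A \<Longrightarrow> k \<in> A \<Longrightarrow> norm (coord scal b j f)
      \<le> norm (coord scal b k f))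
        \<Longrightarrow> norm (f - coord_proj scal b A f) \<le> C * norm f"
    unfolding quasi_greedy_basis_def by metis
  have bdd: "bdd_above (range (\<lambda>j. norm (b j)))" and inf: "0 < (INF j. norm (b j))"
    using assms unfolding quasi_greedy_basis_def by auto
  obtain B where B: "\<And>j. norm (b j) \<le> B"
    using bdd unfolding bdd_above_def by auto
  show thesis
  proof (rule that[of "max C 1" "INF j. norm (b j)" B])
    have "(INF j. norm (b j)) \<le> norm (b j)" for j
      by (rule cINF_lower) (auto intro!: bdd_belowI[of _ 0])
    then show "\<forall>j. (INF j. norm (b j)) \<le> norm (b j) \<and> norm (b j) \<le> B"
      using B by simp
    have "norm (f - (\<Sum>n\<in>A. scal (coord scal b n f) (b n))) \<le> max C 1 * norm f"
      if "finite A" "\<forall>j k. j \<notin> A \<longrightarrow> k \<in> A \<longrightarrow> norm (coord scal b j f) \<le> norm (coord scal b k f)" for f A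
    proof -
      have "norm (f - (\<Sum>n\<in>A. scal (coord scal b n f) (b n))) \<le> C * norm f"
        using C[of A f] that by (simp add: coord_proj_finite)
      also have "\<dots> \<le> max C 1 * norm f" by (intro mult_right_mono) auto
      finally show ?thesis .
    qed
    then show "finite_greedy_bound b (max C 1)"
      unfolding finite_greedy_bound_def by blast
  qed (use assms inf in \<open>auto simp: quasi_greedy_basis_def\<close>)
qed

lemma coord_tendsto_0:
  assumes "schauder_basis scal b" and "0 < \<delta>" and "\<And>j. \<delta> \<le> norm (b j)"
  shows "(\<lambda>n. coord scal b n f) \<longlonglongrightarrow> 0"
proof -
  have "(\<lambda>n. scal (coord scal b n f) (b n)) \<longlonglongrightarrow> 0"
    using coord_sums[OF assms(1)] sums_summable summable_LIMSEQ_zero by blast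
  then have lim: "(\<lambda>n. norm (scal (coord scal b n f) (b n)) / \<delta>) \<longlonglongrightarrow> 0"
    using assms(2) tendsto_norm_zero[of "\<lambda>n. scal (coord scal b n f) (b n)" sequentially]
      tendsto_divide_zero by blast
  show ?thesis
  proof (rule Lim_null_comparison[OF _ lim], rule always_eventually, rule allI)
    fix n
    have "norm (coord scal b n f) * \<delta> \<le> norm (scal (coord scal b n f) (b n))"
      by (simp add: norm_scale mult_left_mono assms(3))
    then show "norm (coord scal b n f) \<le> norm (scal (coord scal b n f) (b n)) / \<delta>"
      using assms(2) by (simp add: field_simps)
  qed
qed

text \<open>The terms of a convergent expansion tend to 0 and the basis vectors are bounded below.
  Superlevel sets of the coefficients are thus finite, and so are available as finite greedy
  sets.\<close>

lemma finite_coord_ge: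
  assumes "schauder_basis scal b" and "0 < \<delta>" and "\<And>j. \<delta> \<le> norm (b j)" and "0 < e"
  shows "finite {j. e \<le> norm (coord scal b j f)}"
proof -
  have "eventually (\<lambda>n. norm (coord scal b n f) < e) sequentially"
    using tendstoD[OF coord_tendsto_0[OF assms(1-3)] assms(4)] by simp
  then obtain N where N: "\<And>n. n \<ge> N \<Longrightarrow> norm (coord scal b n f) < e"
    unfolding eventually_sequentially by auto
  have "{j. e \<le> norm (coord scal b j f)} \<subseteq> {..<N}"
    using N by (force simp: not_less[symmetric])
  then show ?thesis using finite_subset by blast
qed

text \<open>The superlevel set of the coefficient at \<open>n\<close> is greedy both with and
  without \<open>n\<close>, where the minimum is attained. The difference of the two remainders is
  the single term at \<open>n\<close>.\<close>

lemma quasi_greedy_coord_bounded: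
  assumes "quasi_greedy_basis scal b"
  obtains K where "0 < K" "\<And>n f. norm (coord scal b n f) \<le> K * norm f"
proof -
  obtain C \<delta> B where *: "0 < C" "0 < \<delta>" "schauder_basis scal b" "\<forall>j. \<delta> \<le> norm (b j) \<and> norm (b j)
      \<le> B" and qg: "finite_greedy_bound b C"
    by (rule quasi_greedyD[OF assms])
  have "norm (coord scal b n f) \<le> (2 * C / \<delta>) * norm f" for n f
  proof (cases "coord scal b n f = 0")
    case True
    then show ?thesis using * by simp
  next
    case False
    define F where "F = {j. norm (coord scal b n f) \<le> norm (coord scal b j f)}"
    have fin: "finite F" unfolding F_def
      by (rule finite_coord_ge[OF *(3,2)]) (use False *(4) in auto)
    let ?S = "\<lambda>A. \<Sum>n\<in>A. scal (coord scal b n f) (b n)"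
    have 1: "norm (f - ?S F) \<le> C * norm f" by (rule finite_greedy_boundD[OF qg]) (use fin in \<open>auto
        simp: F_def\<close>)
    have 2: "norm (f - ?S (F - {n})) \<le> C * norm f"
        by (rule finite_greedy_boundD[OF qg]) (use fin in \<open>auto simp: F_def\<close>)
    have "n \<in> F" by (simp add: F_def)
    then have "scal (coord scal b n f) (b n) = (f - ?S (F - {n})) - (f - ?S F)"
      using sum.remove[OF fin, of n "\<lambda>n. scal (coord scal b n f) (b n)"] by simp
    then have "norm (coord scal b n f) * norm (b n) \<le> 2 * C * norm f"
      using norm_triangle_ineq4[of "f - ?S (F - {n})" "f - ?S F"] 1 2
      by (simp add: norm_scale[symmetric])
    moreover have "norm (coord scal b n f) * \<delta> \<le> norm (coord scal b n f) * norm (b n)"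
      using *(4) by (simp add: mult_left_mono)
    ultimately show ?thesis using *(2) by (simp add: field_simps)
  qed
  then show thesis using that[of "2 * C / \<delta>"] * by simp
qed

text \<open>The weights \<open>t / \<bar>a n\<bar>\<close> flatten the coefficients on the block to modulus \<open>t\<close>. Then all
  coefficients are tied, every subset is greedy, and the weights \<open>\<bar>a n\<bar> / t\<close> restore the original
  coefficients.\<close>

lemma quasi_greedy_level_block:
  assumes "quasi_greedy_basis scal b"
  obtains K where "0 < K"
    "\<And>D a t B. finite D \<Longrightarrow> 0 < t \<Longrightarrow> B \<subseteq> {n \<in> D. t < norm (a n) \<and> norm (a n) \<le> 2 * t} \<Longrightarrow>
      norm (\<Sum>n\<in>B. scal (a n) (b n)) \<le> K * norm (\<Sum>n\<in>D. scal (a n) (b n))"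
proof -
  obtain C \<delta> B where C: "0 < C" and "0 < \<delta>" and sb: "schauder_basis scal b"
    and "\<forall>j. \<delta> \<le> norm (b j) \<and> norm (b j) \<le> B" and qg: "finite_greedy_bound b C"
    by (rule quasi_greedyD[OF assms])
  have qg': "norm (\<Sum>n\<in>D - A. scal (a n) (b n)) \<le> C * norm (\<Sum>n\<in>D. scal (a n) (b n))"
    if "finite D" "A \<subseteq> D" "\<And>j k. j \<in> D - A \<Longrightarrow> k \<in> A \<Longrightarrow> norm (a j) \<le> norm (a k)" for D A a
  proof -
    have "norm ((\<Sum>n\<in>D. scal (a n) (b n)) - (\<Sum>n\<in>A. scal (coord scal b n (\<Sum>n\<in>D. scal (a n) (b n))) (b n)))
        \<le> C * norm (\<Sum>n\<in>D. scal (a n) (b n))"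
      by (rule finite_greedy_boundD[OF qg]) (use that finite_subset[OF that(2,1)] in \<open>auto simp:
          coord_finite_sum[OF sb that(1)]\<close>)
    moreover have "(\<Sum>n\<in>A. scal (coord scal b n (\<Sum>n\<in>D. scal (a n) (b n))) (b n))
        = (\<Sum>n\<in>A. scal (a n) (b n))"
      by (rule sum.cong) (use that in \<open>auto simp: coord_finite_sum[OF sb that(1)]\<close>)
    ultimately show ?thesis using that by (simp add: sum_diff)
  qed
  have gr: "norm (\<Sum>n\<in>A. scal (a n) (b n)) \<le> (1 + C) * norm (\<Sum>n\<in>D. scal (a n) (b n))"
    if "finite D" "A \<subseteq> D" "\<And>j k. j \<in> D - A \<Longrightarrow> k \<in> A \<Longrightarrow> norm (a j) \<le> norm (a k)" for D A a
  proof -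
    have eq: "(\<Sum>n\<in>A. scal (a n) (b n)) = (\<Sum>n\<in>D. scal (a n) (b n)) - (\<Sum>n\<in>D - A. scal (a n) (b n))"
      using that by (simp add: sum_diff)
    have "norm (\<Sum>n\<in>A. scal (a n) (b n)) \<le> norm (\<Sum>n\<in>D. scal (a n) (b n))
        + norm (\<Sum>n\<in>D - A. scal (a n) (b n))"
      unfolding eq by (rule norm_triangle_ineq4)
    also have "norm (\<Sum>n\<in>D - A. scal (a n) (b n)) \<le> C * norm (\<Sum>n\<in>D. scal (a n) (b n))"
      by (rule qg'[OF that(1,2)]) (rule that(3))
    finally show ?thesis by (simp add: algebra_simps)
  qed
  \<comment> \<open>From the right: \<open>2 * (1 + C)\<close> for cutting out the dyadic band as a
    difference of two greedy sums, \<open>C\<close> for flattening it, \<open>1 + C\<close> for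
    passing to a subset of the flat vector, and 2 as the bound of the restoring weights.\<close>
  define K where "K = 2 * ((1 + C) * (C * (2 * (1 + C))))"
  have main: "norm (\<Sum>n\<in>B. scal (a n) (b n)) \<le> K * norm (\<Sum>n\<in>D. scal (a n) (b n))"
    if D: "finite D" and t: "0 < t" and B: "B \<subseteq> {n \<in> D. t < norm (a n) \<and> norm (a n)
        \<le> 2 * t}" for D a t B
  proof -
    let ?f = "norm (\<Sum>n\<in>D. scal (a n) (b n))"
    define G where "G = {n \<in> D. t < norm (a n) \<and> norm (a n) \<le> 2 * t}"
    have finG: "finite G" using D by (simp add: G_def)
    have BG: "B \<subseteq> G" using B by (simp add: G_def)
    have finB: "finite B" using BG finG finite_subset by blast
    have G: "norm (\<Sum>n\<in>G. scal (a n) (b n)) \<le> 2 * (1 + C) * ?f"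
    proof -
      have Geq: "G = {n \<in> D. t < norm (a n)} - {n \<in> D. 2 * t < norm (a n)}"
        using t by (auto simp: G_def)
      have "(\<Sum>n\<in>G. scal (a n) (b n)) = (\<Sum>n | n \<in> D \<and> t < norm (a n). scal (a n) (b n))
          - (\<Sum>n | n \<in> D \<and> 2 * t < norm (a n). scal (a n) (b n))"
        unfolding Geq by (rule sum_diff) (use D t in auto)
      moreover have "norm (\<Sum>n | n \<in> D \<and> t < norm (a n). scal (a n) (b n)) \<le> (1 + C) * ?f"
        by (rule gr) (use D in auto)
      moreover have "norm (\<Sum>n | n \<in> D \<and> 2 * t < norm (a n). scal (a n) (b n)) \<le> (1 + C) * ?f"
        by (rule gr) (use D in auto)
      ultimately have "norm (\<Sum>n\<in>G. scal (a n) (b n)) \<le> (1 + C) * ?f + (1 + C) * ?f"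
        by (simp only: norm_triangle_le_diff[OF add_mono])
      then show ?thesis by (simp add: algebra_simps)
    qed
    define e where "e n = of_real (t / norm (a n)) * a n" for n
    have anz: "norm (a n) > 0" if "n \<in> G" for n using that t by (auto simp: G_def)
    have norm_e: "norm (e n) = t" if "n \<in> G" for n
      using anz[OF that] t unfolding e_def norm_mult norm_of_real by simp
    have e_scal: "scal (e n) x = (t / norm (a n)) *\<^sub>R scal (a n) x" for n x
      by (simp only: e_def scale_scale[symmetric] scale_of_real)
    have E: "norm (\<Sum>n\<in>G. scal (e n) (b n)) \<le> 1 * (C * (2 * (1 + C) * ?f))"
      unfolding e_scal
    proof (rule layer_cake_bound[OF finG])
      show "0 \<le> t / norm (a n) \<and> t / norm (a n) \<le> 1" if "n \<in> G" for n
        using that t anz[OF that] by (simp add: G_def divide_le_eq)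
      show "norm (\<Sum>n | n \<in> G \<and> c < t / norm (a n). scal (a n) (b n)) \<le> C * (2 * (1 + C) * ?f)" for c
      proof -
        \<comment> \<open>A large weight \<open>t / norm (a n)\<close> means a small coefficient, so
          the superlevel sets of the weights are complements of greedy sets; hence
          \<open>qg'\<close> and not \<open>gr\<close>.\<close>
        define A where "A = {n \<in> G. t / norm (a n) \<le> c}"
        have "{n. n \<in> G \<and> c < t / norm (a n)} = G - A" by (auto simp: A_def)
        moreover have "norm (\<Sum>n\<in>G - A. scal (a n) (b n)) \<le> C * norm (\<Sum>n\<in>G. scal (a n) (b n))"
        proof (rule qg'[OF finG])
          show "norm (a j) \<le> norm (a k)" if "j \<in> G - A" "k \<in> A" for j k
          proof -
            have "t / norm (a k) < t / norm (a j)" "k \<in> G" "j \<in> G" using that by (auto simp: A_def)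
            then have "t * norm (a j) < t * norm (a k)"
              using anz[of j] anz[of k] by (simp add: field_simps)
            then show ?thesis using t by simp
          qed
        qed (auto simp: A_def)
        ultimately show ?thesis using mult_left_mono[OF G, of C] C by (simp add: algebra_simps)
      qed
    qed simp
    have "norm (\<Sum>n\<in>B. (norm (a n) / t) *\<^sub>R scal (e n) (b n)) \<le> 2 * ((1 + C) * (C * (2 * (1 + C) * ?f)))"
    proof (rule layer_cake_bound[OF finB])
      show "0 \<le> norm (a n) / t \<and> norm (a n) / t \<le> 2" if "n \<in> B" for n
        using that t BG by (auto simp: G_def divide_le_eq)
      show "norm (\<Sum>n | n \<in> B \<and> c < norm (a n) / t. scal (e n) (b n)) \<le> (1 + C) * (C * (2 * (1
          + C) * ?f))" for c
      proof -
        have "norm (\<Sum>n | n \<in> B \<and> c < norm (a n) / t. scal (e n) (b n)) \<le> (1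
            + C) * norm (\<Sum>n\<in>G. scal (e n) (b n))"
        proof (rule gr[OF finG])
          show "norm (e j) \<le> norm (e k)" if "j \<in> G - {n. n \<in> B
              \<and> c < norm (a n) / t}" "k \<in> {n. n \<in> B \<and> c < norm (a n) / t}" for j k
            using that BG by (simp add: norm_e subset_iff)
        qed (use BG in auto)
        also have "\<dots> \<le> (1 + C) * (C * (2 * (1 + C) * ?f))"
          using mult_left_mono[OF E, of "1 + C"] C by simp
        finally show ?thesis .
      qed
    qed simp
    moreover have "(\<Sum>n\<in>B. (norm (a n) / t) *\<^sub>R scal (e n) (b n)) = (\<Sum>n\<in>B. scal (a n) (b n))"
    proof (rule sum.cong)
      fix n assume "n \<in> B"
      then have "norm (a n) > 0" using anz BG by auto
      then show "(norm (a n) / t) *\<^sub>R scal (e n) (b n) = scal (a n) (b n)"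
        using t by (simp add: e_scal)
    qed simp
    ultimately show ?thesis by (simp add: K_def algebra_simps)
  qed
  show thesis by (rule that[of K]) (use main C in \<open>auto simp: K_def\<close>)
qed

lemma quasi_greedy_proj_bound:
  assumes "quasi_greedy_basis scal b"
  obtains K where "0 < K"
    "\<And>m A f. 2 \<le> m \<Longrightarrow> supp scal b f \<subseteq> {..<m} \<Longrightarrow>
      norm (coord_proj scal b A f) \<le> K * ln (real m) * norm f"
proof -
  obtain C \<delta> B where sb: "schauder_basis scal b" and B: "\<forall>j. \<delta> \<le> norm (b j) \<and> norm (b j) \<le> B"
    and "0 < C" and "0 < \<delta>" and "finite_greedy_bound b C"
    using quasi_greedyD[OF assms] by metis
  have B0: "0 \<le> B" using B norm_ge_zero order_trans by blast
  obtain K1 where K1: "0 < K1" "\<And>n f. norm (coord scal b n f) \<le> K1 * norm f"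
    by (rule quasi_greedy_coord_bounded[OF assms]) blast
  obtain K2 where K2: "0 < K2"
    "\<And>D a t B. finite D \<Longrightarrow> 0 < t \<Longrightarrow> B \<subseteq> {n \<in> D. t < norm (a n) \<and> norm (a n) \<le> 2 * t} \<Longrightarrow>
      norm (\<Sum>n\<in>B. scal (a n) (b n)) \<le> K2 * norm (\<Sum>n\<in>D. scal (a n) (b n))"
    by (rule quasi_greedy_level_block[OF assms]) blast
  \<comment> \<open>\<open>2 * K2\<close> pays for the \<open>J\<close> dyadic bands, where
    \<open>J * ln 2 \<le> 2 * ln m\<close>. \<open>K1 * B\<close> pays for the coefficients below
    them, a bound free of \<open>m\<close> that is absorbed through
    \<open>ln 2 \<le> ln m\<close>.\<close>
  define K where "K = (2 * K2 + K1 * B) / ln 2"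
  have main: "norm (coord_proj scal b A f) \<le> K * ln (real m) * norm f"
    if m: "2 \<le> m" and su: "supp scal b f \<subseteq> {..<m}" for m A f
  proof (cases "f = 0")
    case True
    then have "coord scal b n f = 0" for n using K1(2)[of n f] by simp
    then show ?thesis using True by (simp add: coord_proj_def cong: if_cong)
  next
    case False
    define a where "a n = coord scal b n f" for n
    have a0: "a n = 0" if "n \<notin> {..<m}" for n
      using su that by (auto simp: supp_def a_def)
    have "(\<lambda>n. scal (a n) (b n)) sums (\<Sum>n<m. scal (a n) (b n))"
      by (rule sums_finite) (use a0 in auto)
    then have f: "f = (\<Sum>n<m. scal (a n) (b n))"
      using sums_unique2 coord_sums[OF sb, of f] unfolding a_def by blast
    have "(\<lambda>n. if n \<in> A then scal (coord scal b n f) (b n) else 0) sums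
        (\<Sum>n\<in>{..<m} \<inter> A. if n \<in> A then scal (coord scal b n f) (b n) else 0)"
      by (rule sums_finite) (use a0 in \<open>auto simp: a_def\<close>)
    then have p: "coord_proj scal b A f = (\<Sum>n\<in>{..<m} \<inter> A. scal (a n) (b n))"
      unfolding coord_proj_def a_def by (simp add: sums_unique[symmetric])
    define \<alpha> where "\<alpha> = K1 * norm f"
    have \<alpha>: "0 < \<alpha>" "\<And>n. norm (a n) \<le> \<alpha>" using K1 False by (auto simp: \<alpha>_def a_def)
    let ?M = "{..<m} \<inter> A"
    \<comment> \<open>There are about \<open>log 2 m\<close> dyadic blocks above \<open>\<alpha> / m\<close>, and at most \<open>m\<close> coefficients below.\<close>
    have big: "norm (\<Sum>n | n \<in> ?M \<and> \<alpha> / 2 ^ J < norm (a n). scal (a n) (b n))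
        \<le> real J * (K2 * norm f)" for J
    proof (induction J)
      case 0
      have "{n. n \<in> ?M \<and> \<alpha> / 2 ^ 0 < norm (a n)} = {}" using \<alpha>(2) by (auto simp: not_less)
      then show ?case by (simp only: sum.empty) simp
    next
      case (Suc J)
      let ?t = "\<alpha> / 2 ^ Suc J"
      let ?N = "{n \<in> ?M. ?t < norm (a n) \<and> norm (a n) \<le> 2 * ?t}"
      let ?O = "{n. n \<in> ?M \<and> \<alpha> / 2 ^ J < norm (a n)}"
      have t: "2 * ?t = \<alpha> / 2 ^ J" "0 < ?t" using \<alpha>(1) by simp_all
      then have le: "?t < \<alpha> / 2 ^ J" by linarith
      have "{n. n \<in> ?M \<and> ?t < norm (a n)} = ?O \<union> ?N" unfolding t(1) using le by auto
      moreover have "?O \<inter> ?N = {}" unfolding t(1) by auto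
      ultimately have "(\<Sum>n | n \<in> ?M \<and> ?t < norm (a n). scal (a n) (b n))
        = (\<Sum>n\<in>?O. scal (a n) (b n)) + (\<Sum>n\<in>?N. scal (a n) (b n))"
        by (simp add: sum.union_disjoint)
      moreover have "norm (\<Sum>n\<in>?N. scal (a n) (b n)) \<le> K2 * norm f"
        unfolding f by (rule K2(2)) (use t in auto)
      ultimately show ?case
        using Suc norm_triangle_ineq[of "\<Sum>n\<in>?O. scal (a n) (b n)" "\<Sum>n\<in>?N. scal (a n) (b n)"]
        by (simp add: algebra_simps)
    qed
    obtain J0 where J0: "2 ^ J0 \<le> m" "m < 2 ^ (J0 + 1)"
      using ex_power_ivl1[of 2 m] m by auto
    \<comment> \<open>One more than the floor of the binary logarithm, so that
      \<open>m \<le> 2 ^ J\<close> and the at most \<open>m\<close> small terms add up to no more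
      than \<open>\<alpha> * B\<close>.\<close>
    define J where "J = Suc J0"
    have mJ: "real m \<le> 2 ^ J" using J0(2) of_nat_mono[of m "2 ^ J", where 'a = real]
        by (simp add: J_def)
    have "real J0 * ln 2 = ln (2 ^ J0)" by (simp add: ln_realpow)
    also have "\<dots> \<le> ln (real m)"
    proof -
      have "(2::real) ^ J0 \<le> real m" using of_nat_mono[OF J0(1), where 'a = real] by simp
      then show ?thesis using m by (subst ln_le_cancel_iff) simp_all
    qed
    finally have J0le: "real J0 * ln 2 \<le> ln (real m)" .
    have ln2: "ln 2 \<le> ln (real m)" using m by simp
    have Jle: "real J * ln 2 \<le> 2 * ln (real m)" using J0le ln2 by (simp add: J_def algebra_simps)
    let ?R = "{n \<in> ?M. norm (a n) \<le> \<alpha> / 2 ^ J}"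
    have "norm (\<Sum>n\<in>?R. scal (a n) (b n)) \<le> (\<Sum>n\<in>?R. \<alpha> / 2 ^ J * B)"
    proof (rule sum_norm_le)
      fix n assume "n \<in> ?R"
      then show "norm (scal (a n) (b n)) \<le> \<alpha> / 2 ^ J * B"
        unfolding norm_scale by (intro mult_mono) (use B \<alpha>(1) in auto)
    qed
    also have "\<dots> \<le> real m * (\<alpha> / 2 ^ J * B)"
    proof -
      have "card ?R \<le> card {..<m}" by (rule card_mono) auto
      then have "real (card ?R) * (\<alpha> / 2 ^ J * B) \<le> real m * (\<alpha> / 2 ^ J * B)"
        using \<alpha>(1) B0 by (intro mult_right_mono) auto
      then show ?thesis by simp
    qed
    also have "\<dots> \<le> 2 ^ J * (\<alpha> / 2 ^ J * B)"
      by (rule mult_right_mono[OF mJ]) (use \<alpha> B0 in simp)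
    finally have small: "norm (\<Sum>n\<in>?R. scal (a n) (b n)) \<le> \<alpha> * B" by simp
    have split: "?M = {n. n \<in> ?M \<and> \<alpha> / 2 ^ J < norm (a n)} \<union> ?R" by auto
    have "coord_proj scal b A f = (\<Sum>n | n \<in> ?M \<and> \<alpha> / 2 ^ J < norm (a n). scal (a n) (b n))
        + (\<Sum>n\<in>?R. scal (a n) (b n))"
      unfolding p by (subst split, rule sum.union_disjoint) auto
    then have "norm (coord_proj scal b A f) \<le> real J * (K2 * norm f) + \<alpha> * B"
      using norm_triangle_le[OF add_mono[OF big[of J] small]] by simp
    then have "ln 2 * norm (coord_proj scal b A f) \<le> ln 2 * (real J * (K2 * norm f) + \<alpha> * B)"
      by (intro mult_left_mono) auto
    also have "\<dots> = (real J * ln 2) * (K2 * norm f) + ln 2 * (K1 * norm f * B)"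
      by (simp add: \<alpha>_def algebra_simps)
    also have "\<dots> \<le> (2 * ln (real m)) * (K2 * norm f) + ln (real m) * (K1 * norm f * B)"
      using K1(1) K2(1) B0 Jle ln2 by (intro add_mono mult_right_mono) auto
    also have "\<dots> = (2 * K2 + K1 * B) * (ln (real m) * norm f)"
      by (simp add: algebra_simps)
    also have "2 * K2 + K1 * B = ln 2 * K" by (simp add: K_def)
    finally have "ln 2 * norm (coord_proj scal b A f) \<le> ln 2 * (K * ln (real m) * norm f)"
      by (simp add: mult.assoc)
    then show ?thesis by simp
  qed
  have "0 < K" using K1(1) K2(1) B0 by (simp add: K_def add_pos_nonneg)
  then show thesis using that main by blast
qed

end

section \<open>Criteria for quasi-greedy bases\<close>

lemma sums_even_positions:
  fixes f :: "nat \<Rightarrow> 'a::real_normed_vector"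
  assumes "f sums x"
  shows "(\<lambda>n. if even n then f (n div 2) else 0) sums x"
proof -
  have eq: "(\<Sum>n<N. if even n then f (n div 2) else 0) = (\<Sum>j<Suc N div 2. f j)" for N
    by (induction N) auto
  have "filterlim (\<lambda>N. Suc N div 2) at_top sequentially"
    unfolding filterlim_at_top eventually_sequentially
  proof
    fix Z show "\<exists>N. \<forall>n\<ge>N. Z \<le> Suc n div 2" by (intro exI[of _ "2 * Z"]) auto
  qed
  then show ?thesis
    using filterlim_compose[OF assms[unfolded sums_def]] unfolding sums_def eq by blast
qed

lemma sums_odd_positions:
  fixes f :: "nat \<Rightarrow> 'a::real_normed_vector"
  assumes "f sums x"
  shows "(\<lambda>n. if even n then 0 else f (n div 2)) sums x"
proof -
  define g where "g = (\<lambda>n. if even n then 0 else f (n div 2))"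
  have "(\<lambda>n. g (Suc n)) = (\<lambda>n. if even n then f (n div 2) else 0)"
    by (auto simp: g_def)
  then have "g sums (x + g 0)" using sums_Suc[of g x] sums_even_positions[OF assms] by simp
  then show ?thesis by (simp add: g_def)
qed

section \<open>Interleaved sequences and tests for a quasi-greedy basis\<close>

definition interleave :: "(nat \<Rightarrow> 'x) \<Rightarrow> (nat \<Rightarrow> 'x) \<Rightarrow> nat \<Rightarrow> 'x" where
  "interleave p r n = (if even n then p (n div 2) else r (n div 2))"

lemma sum_interleave:
  assumes "finite A"
  shows "(\<Sum>n\<in>A. interleave p r n) = (\<Sum>j | 2 * j \<in> A. p j) + (\<Sum>j | Suc (2 * j) \<in> A. r j)"
proof -
  have "(\<Sum>n\<in>A. interleave p r n) = (\<Sum>n | n \<in> A \<and> even n. interleave p r n) + (\<Sum>n | n \<in> A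
      \<and> odd n. interleave p r n)"
    using assms by (subst sum.union_disjoint[symmetric]) (auto intro!: sum.cong)
  also have "(\<Sum>n | n \<in> A \<and> even n. interleave p r n) = (\<Sum>j | 2 * j \<in> A. p j)"
    by (rule sum.reindex_bij_witness[of _ "\<lambda>j. 2 * j" "\<lambda>n. n div 2"]) (auto simp: interleave_def)
  also have "(\<Sum>n | n \<in> A \<and> odd n. interleave p r n) = (\<Sum>j | Suc (2 * j) \<in> A. r j)"
    by (rule sum.reindex_bij_witness[of _ "\<lambda>j. Suc (2 * j)" "\<lambda>n. n div 2"]) (auto simp: interleave_def)
  finally show ?thesis .
qed

context banach_space_over
begin

text \<open>Uniqueness of the expansion: the functional \<open>c n\<close> is continuous, and
  applied term by term it isolates the coefficient at \<open>n\<close>.\<close>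

lemma coordinate_functional_coord:
  assumes add: "\<And>n f g. c n (f + g) = c n f + c n g"
    and scal: "\<And>n r f. c n (scal r f) = r * c n f"
    and bound: "\<And>n f. norm (c n f) \<le> K * norm f"
    and bio: "\<And>n m. c n (b m) = (if n = m then 1 else 0)"
    and sums: "\<And>f. (\<lambda>n. scal (c n f) (b n)) sums f"
  shows "schauder_basis scal b" and "coord scal b n f = c n f"
proof -
  have lin: "bounded_linear (c n)" for n
  proof (rule bounded_linear_intro)
    show "c n (r *\<^sub>R x) = r *\<^sub>R c n x" for r x
      using scal[of n "of_real r" x] by (simp add: scale_of_real scaleR_conv_of_real)
    show "norm (c n x) \<le> norm x * K" for x using bound[of n x] by (simp add: mult.commute)
  qed (rule add)
  have unique: "a = (\<lambda>n. c n f)" if "(\<lambda>n. scal (a n) (b n)) sums f" for a f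
  proof
    fix n
    have "(\<lambda>k. c n (scal (a k) (b k))) sums c n f" by (rule bounded_linear.sums[OF lin that])
    moreover have "(\<lambda>k. c n (scal (a k) (b k))) = (\<lambda>k. if k = n then a k else 0)"
      by (auto simp: scal bio)
    ultimately have "(\<lambda>k. if k = n then a k else 0) sums c n f" by simp
    then show "a n = c n f" using sums_unique2 sums_single[of n a] by blast
  qed
  show sb: "schauder_basis scal b"
    unfolding schauder_basis_def
  proof
    fix f
    show "\<exists>!a. (\<lambda>n. scal (a n) (b n)) sums f"
      by (rule ex1I[of _ "\<lambda>n. c n f"]) (fact sums, fact unique)
  qed
  show "coord scal b n f = c n f" by (rule coord_eqI[OF sb sums])
qed

text \<open>Finite greedy sets suffice. If a nonzero coefficient lay outside an infinite greedy set,
  the set would be contained in a finite superlevel set; so it contains the support and its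
  projection is the identity on \<open>f\<close>. The lower bound of the norms comes from
  \<open>c n (b n) = 1\<close>.\<close>

lemma quasi_greedy_basisI:
  assumes add: "\<And>n f g. c n (f + g) = c n f + c n g"
    and scal: "\<And>n r f. c n (scal r f) = r * c n f"
    and bound: "\<And>n f. norm (c n f) \<le> K * norm f"
    and bio: "\<And>n m. c n (b m) = (if n = m then 1 else 0)"
    and sums: "\<And>f. (\<lambda>n. scal (c n f) (b n)) sums f"
    and bdd: "\<And>n. norm (b n) \<le> B"
    and greedy: "\<And>f A. finite A \<Longrightarrow> (\<And>j k. j \<notin> A \<Longrightarrow> k \<in> A \<Longrightarrow> norm (c j f) \<le> norm (c k f)) \<Longrightarrow>
      norm (\<Sum>n\<in>A. scal (c n f) (b n)) \<le> C * norm f"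
  shows "quasi_greedy_basis scal b"
proof -
  have sb: "schauder_basis scal b" and coord: "coord scal b n f = c n f" for n f
    by (rule coordinate_functional_coord[of c K b, OF add scal bound bio sums])+
  have one: "1 \<le> K * norm (b n)" for n using bound[of n "b n"] by (simp add: bio)
  have K: "0 < K"
    using one[of 0] by (smt (verit) mult_nonpos_nonneg norm_ge_zero)
  have low: "1 / K \<le> norm (b n)" for n using one[of n] K by (simp add: divide_le_eq mult.commute)
  have "1 / K \<le> (INF j. norm (b j))" by (rule cINF_greatest) (use low in auto)
  moreover have "0 < 1 / K" using K by simp
  ultimately have inf: "0 < (INF j. norm (b j))" by linarith
  have "norm (f - coord_proj scal b A f) \<le> (1 + \<bar>C\<bar>) * norm f"
    if A: "\<forall>j k. j \<notin> A \<longrightarrow> k \<in> A \<longrightarrow> norm (coord scal b j f) \<le> norm (coord scal b k f)" for f A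
  proof (cases "finite A")
    case True
    have "norm (\<Sum>n\<in>A. scal (c n f) (b n)) \<le> C * norm f"
      by (rule greedy[OF True]) (use A in \<open>simp add: coord\<close>)
    also have "\<dots> \<le> \<bar>C\<bar> * norm f" by (intro mult_right_mono) auto
    finally show ?thesis
      using norm_triangle_ineq4[of f "\<Sum>n\<in>A. scal (c n f) (b n)"]
      by (simp add: coord_proj_finite[OF True] coord algebra_simps)
  next
    case False
    have "c j f = 0" if j: "j \<notin> A" for j
    proof (rule ccontr)
      assume "c j f \<noteq> 0"
      then have "finite {k. norm (c j f) \<le> norm (c k f)}"
        using finite_coord_ge[OF sb \<open>0 < 1 / K\<close> low, of "norm (c j f)" f] by (simp add: coord)
      moreover have "A \<subseteq> {k. norm (c j f) \<le> norm (c k f)}" using A j by (auto simp: coord)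
      ultimately show False using False finite_subset by blast
    qed
    then have "(\<lambda>n. if n \<in> A then scal (coord scal b n f) (b n) else 0) = (\<lambda>n. scal (c n f) (b n))"
      by (auto simp: coord)
    then have "coord_proj scal b A f = f"
      using sums_unique[OF sums[of f]] by (simp add: coord_proj_def)
    then show ?thesis by simp
  qed
  then have "\<exists>C. \<forall>f A. (\<forall>j k. j \<notin> A \<longrightarrow> k \<in> A \<longrightarrow> norm (coord scal b j f) \<le> norm (coord scal b k f))
        \<longrightarrow> norm (f - coord_proj scal b A f) \<le> C * norm f"
    by blast
  moreover have "bdd_above (range (\<lambda>j. norm (b j)))" using bdd by (intro bdd_aboveI[of _ B]) auto
  ultimately show ?thesis using sb inf unfolding quasi_greedy_basis_def by blast
qed

text \<open>A greedy set for the interleaved coefficients meets the even and the odd positions in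
  sets that are greedy for the respective half.\<close>

lemma interleave_greedy_bound:
  fixes p r :: "nat \<Rightarrow> 'a" and a d :: "nat \<Rightarrow> 'k"
  assumes "finite A"
    and greedy: "\<And>j k. j \<notin> A \<Longrightarrow> k \<in> A \<Longrightarrow> norm (interleave a d j) \<le> norm (interleave a d k)"
    and p: "\<And>A. finite A \<Longrightarrow> (\<And>j k. j \<notin> A \<Longrightarrow> k \<in> A \<Longrightarrow> norm (a j) \<le> norm (a k)) \<Longrightarrow>
      norm (\<Sum>n\<in>A. scal (a n) (p n)) \<le> C"
    and r: "\<And>A. finite A \<Longrightarrow> (\<And>j k. j \<notin> A \<Longrightarrow> k \<in> A \<Longrightarrow> norm (d j) \<le> norm (d k)) \<Longrightarrow>
      norm (\<Sum>n\<in>A. scal (d n) (r n)) \<le> D"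
  shows "norm (\<Sum>n\<in>A. scal (interleave a d n) (interleave p r n)) \<le> C + D"
proof -
  have eq: "(\<lambda>n. scal (interleave a d n) (interleave p r n))
      = interleave (\<lambda>j. scal (a j) (p j)) (\<lambda>j. scal (d j) (r j))"
    by (auto simp: interleave_def)
  have "(\<Sum>n\<in>A. scal (interleave a d n) (interleave p r n))
      = (\<Sum>j | 2 * j \<in> A. scal (a j) (p j)) + (\<Sum>j | Suc (2 * j) \<in> A. scal (d j) (r j))"
    unfolding eq by (rule sum_interleave[OF assms(1)])
  moreover have "norm (\<Sum>j | 2 * j \<in> A. scal (a j) (p j)) \<le> C"
  proof (rule p)
    show "finite {j. 2 * j \<in> A}"
      using finite_vimageI[OF assms(1), of "\<lambda>j. 2 * j"] by (simp add: vimage_def inj_on_def)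
    show "norm (a j) \<le> norm (a k)" if "j \<notin> {j. 2 * j \<in> A}" "k \<in> {j. 2 * j \<in> A}" for j k
      using greedy[of "2 * j" "2 * k"] that by (simp add: interleave_def)
  qed
  moreover have "norm (\<Sum>j | Suc (2 * j) \<in> A. scal (d j) (r j)) \<le> D"
  proof (rule r)
    show "finite {j. Suc (2 * j) \<in> A}"
      using finite_vimageI[OF assms(1), of "\<lambda>j. Suc (2 * j)"] by (simp add: vimage_def inj_on_def)
    show "norm (d j) \<le> norm (d k)" if "j \<notin> {j. Suc (2 * j) \<in> A}" "k \<in> {j. Suc (2 * j) \<in> A}" for j k
      using greedy[of "Suc (2 * j)" "Suc (2 * k)"] that by (simp add: interleave_def)
  qed
  ultimately show ?thesis by (simp only: norm_triangle_le[OF add_mono])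
qed

lemma interleave_sums:
  assumes "(\<lambda>n. scal (a n) (p n)) sums x" and "(\<lambda>n. scal (d n) (r n)) sums y"
  shows "(\<lambda>n. scal (interleave a d n) (interleave p r n)) sums (x + y)"
proof -
  have "(\<lambda>n. (if even n then scal (a (n div 2)) (p (n div 2)) else 0)
      + (if even n then 0 else scal (d (n div 2)) (r (n div 2)))) sums (x + y)"
    by (intro sums_add sums_even_positions[OF assms(1)] sums_odd_positions[OF assms(2)])
  moreover have "(\<lambda>n. (if even n then scal (a (n div 2)) (p (n div 2)) else 0)
      + (if even n then 0 else scal (d (n div 2)) (r (n div 2))))
          = (\<lambda>n. scal (interleave a d n) (interleave p r n))"
    by (auto simp: interleave_def)
  ultimately show ?thesis by simp
qed

end

section \<open>A summing-type basis of a c0-sum of l_q-spaces\<close>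

text \<open>The shift by one lets the blocks start at index 0 with exactly \<open>2 ^ k\<close>
  indices on level \<open>k\<close>.\<close>

definition level :: "nat \<Rightarrow> nat" where "level j = floor_log (Suc j)"

lemma level_eq_iff: "level j = k \<longleftrightarrow> 2 ^ k \<le> Suc j \<and> Suc j < 2 ^ Suc k"
proof
  assume "level j = k"
  then show "2 ^ k \<le> Suc j \<and> Suc j < 2 ^ Suc k"
    using floor_log_exp2_le[of "Suc j"] floor_log_exp2_gt[of "Suc j"] by (auto simp: level_def)
next
  assume "2 ^ k \<le> Suc j \<and> Suc j < 2 ^ Suc k"
  then show "level j = k" unfolding level_def by (intro floor_log_eqI) auto
qed

lemma level_mono: "i \<le> j \<Longrightarrow> level i \<le> level j"
  unfolding level_def by (intro floor_log_le_iff) simp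

lemma levels_eq_atLeastLessThan: "{j. level j = k} = {2 ^ k - 1..<2 ^ Suc k - 1}"
proof -
  have "(1::nat) \<le> 2 ^ k" by simp
  then show ?thesis by (auto simp: level_eq_iff)
qed

lemma finite_level_eq [simp]: "finite {j. level j = k}"
  by (simp add: levels_eq_atLeastLessThan)

lemma card_level_eq: "card {j. level j = k} = 2 ^ k"
  unfolding levels_eq_atLeastLessThan by simp

lemma finite_level_less [simp]: "finite {j. level j < n}"
proof -
  have "{j. level j < n} = (\<Union>k<n. {j. level j = k})" by auto
  then show ?thesis by simp
qed

lemma level_0 [simp]: "level 0 = 0"
  by (simp add: level_eq_iff)

locale summing_exponent =
  fixes q :: real
  assumes q_gt_1: "1 < q"
begin

text \<open>On the block \<open>level j = k\<close>, of size \<open>2 ^ k\<close>, the constant function \<open>1 / theta ^ k\<close> is normalized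
  in \<open>l_q\<close> and \<open>avg k\<close> is the functional dual to it.\<close>

definition theta :: real where "theta = 2 powr (1 / q)"
definition mu :: real where "mu = 2 powr (1 - 1 / q)"

lemma theta_gt_1: "1 < theta" and mu_gt_1: "1 < mu"
  using q_gt_1 by (simp_all add: theta_def mu_def)

lemma theta_pos [simp]: "0 < theta" and mu_pos [simp]: "0 < mu"
  using theta_gt_1 mu_gt_1 by simp_all

lemma theta_nonneg [simp]: "0 \<le> theta" and mu_nonneg [simp]: "0 \<le> mu"
  and theta_nonzero [simp]: "theta \<noteq> 0" and mu_nonzero [simp]: "mu \<noteq> 0"
  using theta_pos mu_pos by linarith+

lemma mu_mult_theta: "mu * theta = 2"
  by (simp add: theta_def mu_def flip: powr_add)

lemma mu_mult_theta_power: "mu ^ k * theta ^ k = 2 ^ k"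
  by (simp add: mu_mult_theta flip: power_mult_distrib)

lemma theta_power_powr: "(theta ^ k) powr q = 2 ^ k"
proof -
  have "(theta ^ k) powr q = 2 powr (real k * (1 / q) * q)"
    by (simp add: theta_def powr_powr mult_ac flip: powr_realpow)
  then show ?thesis using q_gt_1 by (simp add: powr_realpow)
qed

lemma theta_power_powr': "(theta ^ k) powr (q - 1) = mu ^ k"
proof -
  have "(theta ^ k) powr (q - 1) = 2 powr (real k * (1 / q) * (q - 1))"
    by (simp add: theta_def powr_powr flip: powr_realpow)
  also have "real k * (1 / q) * (q - 1) = (1 - 1 / q) * real k"
    using q_gt_1 by (simp add: field_simps)
  finally show ?thesis by (simp add: mu_def powr_powr flip: powr_realpow)
qed

text \<open>The q-th power of the norm, without the root. Bounds are written as
  \<open>\<le> M powr q\<close>, so that \<open>M\<close> has the scale of a norm.\<close>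

definition lq_sum :: "nat set \<Rightarrow> (nat \<Rightarrow> 'k::real_normed_field) \<Rightarrow> real" where
  "lq_sum D g = (\<Sum>i\<in>D. norm (g i) powr q)"

lemma lq_sum_mono_dom:
  assumes "\<And>i. i \<in> D \<Longrightarrow> norm (f i) \<le> c * norm (g i)" and "0 \<le> c" and "0 \<le> M" and "lq_sum D g \<le> M powr q"
  shows "lq_sum D f \<le> (c * M) powr q"
proof -
  have "lq_sum D f \<le> (\<Sum>i\<in>D. (c * norm (g i)) powr q)"
    unfolding lq_sum_def using assms(1) q_gt_1 by (intro sum_mono powr_mono2) auto
  also have "\<dots> = c powr q * lq_sum D g"
    unfolding lq_sum_def sum_distrib_left using assms(2) by (intro sum.cong) (auto simp: powr_mult)
  also have "\<dots> \<le> c powr q * M powr q" using assms(4) by (intro mult_left_mono) auto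
  finally show ?thesis using assms by (simp add: powr_mult)
qed

lemma lq_sum_subset: "finite D \<Longrightarrow> B \<subseteq> D \<Longrightarrow> lq_sum B g \<le> lq_sum D g"
  unfolding lq_sum_def by (intro sum_mono2) auto

text \<open>A crude Minkowski inequality: the norm of a sum is at most twice the larger norm, and
  the q-th power is superadditive. The lost factor 2 only enters constants.\<close>

lemma lq_sum_add:
  fixes f g :: "nat \<Rightarrow> 'k::real_normed_field"
  assumes "lq_sum D f \<le> M powr q" and "lq_sum D g \<le> N powr q" and "0 \<le> M" and "0 \<le> N"
  shows "lq_sum D (\<lambda>i. f i + g i) \<le> (2 * (M + N)) powr q"
proof -
  have pt: "norm (a + b) powr q \<le> 2 powr q * (norm a powr q + norm b powr q)" for a b :: 'k
  proof -
    have "norm (a + b) powr q \<le> (2 * max (norm a) (norm b)) powr q"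
      using norm_triangle_ineq[of a b] q_gt_1 by (intro powr_mono2) auto
    also have "\<dots> = 2 powr q * max (norm a) (norm b) powr q" by (simp add: powr_mult)
    also have "\<dots> \<le> 2 powr q * (norm a powr q + norm b powr q)"
      by (intro mult_left_mono) (auto simp: max_def)
    finally show ?thesis .
  qed
  have super: "M powr q + N powr q \<le> (M + N) powr q"
  proof -
    have e: "x powr q = x * x powr (q - 1)" if "0 \<le> x" for x :: real
      using that powr_mult_base[of x "q - 1"] by simp
    have "M powr q + N powr q \<le> M * (M + N) powr (q - 1) + N * (M + N) powr (q - 1)"
      unfolding e[OF assms(3)] e[OF assms(4)] using assms q_gt_1
      by (intro add_mono mult_left_mono powr_mono2) auto
    also have "\<dots> = (M + N) powr q"
      using e[of "M + N"] assms by (simp add: algebra_simps)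
    finally show ?thesis .
  qed
  have "lq_sum D (\<lambda>i. f i + g i) \<le> 2 powr q * (lq_sum D f + lq_sum D g)"
    unfolding lq_sum_def sum_distrib_left sum.distrib[symmetric] by (intro sum_mono) (use pt in simp)
  also have "\<dots> \<le> 2 powr q * (M + N) powr q"
    using assms super by (intro mult_left_mono) auto
  finally show ?thesis by (simp only: powr_mult)
qed

lemma lq_sum_const:
  assumes "D \<subseteq> {j. level j = k}" and "\<And>i. i \<in> D \<Longrightarrow> norm (f i) \<le> c / theta ^ k" and "0 \<le> c"
  shows "lq_sum D f \<le> c powr q"
proof -
  have "card D \<le> 2 ^ k" using card_mono[OF _ assms(1)] by (simp add: card_level_eq)
  then have card: "real (card D) \<le> 2 ^ k" using of_nat_mono[of "card D" "2 ^ k", where 'a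
      = real] by simp
  have "lq_sum D f \<le> (\<Sum>i\<in>D. (c / theta ^ k) powr q)"
    unfolding lq_sum_def using assms(2) q_gt_1 by (intro sum_mono powr_mono2) auto
  also have "\<dots> = real (card D) * (c powr q / 2 ^ k)"
    using assms(3) by (simp add: powr_divide theta_power_powr)
  also have "\<dots> \<le> 2 ^ k * (c powr q / 2 ^ k)"
    using card by (intro mult_right_mono) auto
  finally show ?thesis by simp
qed

text \<open>Above a threshold the first power is controlled by the q-th power, since
  \<open>1 - q\<close> is negative. This stands in for Hoelder's inequality.\<close>

lemma le_powr_of_ge:
  assumes "0 < s" and "s \<le> x"
  shows "x \<le> s powr (1 - q) * x powr q"
proof -
  have "x powr (1 - q) \<le> s powr (1 - q)"
    using assms q_gt_1 by (intro powr_mono2') auto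
  then have "x powr (1 - q) * x powr q \<le> s powr (1 - q) * x powr q"
    by (intro mult_right_mono) auto
  then show ?thesis using assms by (simp flip: powr_add)
qed

text \<open>Hoelder's inequality up to the factor 2; \<open>mu ^ k\<close> is the norm of the
  indicator of a block in the dual exponent.\<close>

lemma level_sum_norm_le:
  assumes "D \<subseteq> {j. level j = k}" and "lq_sum D g \<le> M powr q" and "0 < M"
  shows "(\<Sum>i\<in>D. norm (g i)) \<le> 2 * M * mu ^ k"
proof -
  \<comment> \<open>The threshold that balances the two parts: \<open>2 ^ k * l\<close> and
    \<open>l powr (1 - q) * M powr q\<close> are both \<open>M * mu ^ k\<close>.\<close>
  define l where "l = M / theta ^ k"
  have l: "0 < l" using assms(3) by (simp add: l_def)
  have "card D \<le> 2 ^ k" using card_mono[OF _ assms(1)] by (simp add: card_level_eq)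
  then have card: "real (card D) \<le> 2 ^ k" using of_nat_mono[of "card D" "2 ^ k", where 'a
      = real] by simp
  have "(\<Sum>i\<in>D. norm (g i)) \<le> (\<Sum>i\<in>D. l + l powr (1 - q) * norm (g i) powr q)"
  proof (rule sum_mono)
    fix i
    show "norm (g i) \<le> l + l powr (1 - q) * norm (g i) powr q"
    proof (cases "norm (g i) \<le> l")
      case True
      have "0 \<le> l powr (1 - q) * norm (g i) powr q" by simp
      then show ?thesis using True by linarith
    next
      case False
      then show ?thesis using le_powr_of_ge[OF l, of "norm (g i)"] l by linarith
    qed
  qed
  also have "\<dots> = real (card D) * l + l powr (1 - q) * lq_sum D g"
    by (simp add: sum.distrib lq_sum_def sum_distrib_left)
  also have "\<dots> \<le> 2 ^ k * l + l powr (1 - q) * M powr q"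
    using card l assms(2) by (intro add_mono mult_right_mono mult_left_mono) auto
  also have "2 ^ k * l = M * mu ^ k" by (simp add: l_def mu_mult_theta_power[symmetric] del:
      mult_cancel_left)
  also have "l powr (1 - q) * M powr q = M * mu ^ k"
  proof -
    have "l powr (1 - q) = M powr (1 - q) / (theta ^ k) powr (1 - q)"
      using assms(3) by (simp add: l_def powr_divide)
    also have "(theta ^ k) powr (1 - q) = 1 / mu ^ k"
      using powr_minus_divide[of "theta ^ k" "q - 1"] by (simp add: theta_power_powr')
    finally have "l powr (1 - q) * M powr q = (M powr (1 - q) * M powr q) * mu ^ k" by simp
    then show ?thesis using assms(3) by (simp flip: powr_add)
  qed
  finally show ?thesis by simp
qed

definition avg :: "nat \<Rightarrow> (nat \<Rightarrow> 'k::real_normed_field) \<Rightarrow> 'k" where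
  "avg k g = of_real (1 / mu ^ k) * (\<Sum>i | level i = k. g i)"

text \<open>The coefficients of \<open>g\<close> in the basis \<open>sum_vec\<close>, in which the normalized constant functions of
  the blocks are replaced by the summing basis: \<open>avg k g\<close> becomes the sum of \<open>avg l (sum_coeff g)\<close> over
  \<open>l \<ge> k\<close>.\<close>

definition sum_coeff :: "(nat \<Rightarrow> 'k::real_normed_field) \<Rightarrow> nat \<Rightarrow> 'k" where
  "sum_coeff g i = g i - of_real (1 / theta ^ level i) * avg (Suc (level i)) g"

text \<open>To the unit vector at \<open>j\<close> the normalized constants of all lower blocks are
  added, with the weight \<open>1 / mu ^ level j\<close> that \<open>avg\<close> assigns to the unit
  vector itself. Hence \<open>avg k (sum_vec j)\<close> is the same for all
  \<open>k \<le> level j\<close> and 0 beyond, as for a vector of the summing basis.\<close>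

definition sum_vec :: "nat \<Rightarrow> nat \<Rightarrow> 'k::real_normed_field" where
  "sum_vec j i = (if i = j then 1 else 0) + (if level i < level j then of_real (1 / (mu ^ level j *
      theta ^ level i)) else 0)"

definition synth :: "nat set \<Rightarrow> (nat \<Rightarrow> 'k::real_normed_field) \<Rightarrow> nat \<Rightarrow> 'k" where
  "synth A f i = (\<Sum>j\<in>A. f j * sum_vec j i)"

text \<open>For finite \<open>A\<close> this is \<open>avg k (synth A f)\<close>.\<close>

definition tail :: "nat set \<Rightarrow> (nat \<Rightarrow> 'k::real_normed_field) \<Rightarrow> nat \<Rightarrow> 'k" where
  "tail A f k = (\<Sum>j | j \<in> A \<and> k \<le> level j. of_real (1 / mu ^ level j) * f j)"

lemma norm_avg_le:
  assumes "lq_sum {i. level i = k} g \<le> M powr q" and "0 < M"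
  shows "norm (avg k g) \<le> 2 * M"
proof -
  have "norm (\<Sum>i | level i = k. g i) \<le> 2 * M * mu ^ k"
    using norm_sum[of g "{i. level i = k}"] level_sum_norm_le[OF order_refl assms] by linarith
  then show ?thesis unfolding avg_def norm_mult norm_of_real
    by (simp add: abs_of_pos divide_le_eq mult_ac)
qed

text \<open>Besides the coordinates on \<open>A\<close>, a synthesis consists of one constant per
  block. Norm estimates thus reduce to bounds for the numbers \<open>tail\<close>.\<close>

lemma synth_eq:
  assumes "finite A"
  shows "synth A f i = (if i \<in> A then f i else 0)
      + of_real (1 / theta ^ level i) * tail A f (Suc (level i))"
proof -
  have "synth A f i = (\<Sum>j\<in>A. if i = j then f j else 0)
      + (\<Sum>j\<in>A. if Suc (level i) \<le> level j then of_real (1 / theta ^ level i) * (of_real (1 / mu ^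
          level j) * f j) else 0)"
    unfolding synth_def sum_vec_def sum.distrib[symmetric]
    by (intro sum.cong) (auto simp: algebra_simps Suc_le_eq)
  moreover have "(\<Sum>j\<in>A. if i = j then f j else 0) = (if i \<in> A then f i else 0)"
    using assms by simp
  moreover have "(\<Sum>j\<in>A. if Suc (level i) \<le> level j then of_real (1 / theta ^ level i) * (of_real (1
      / mu ^ level j) * f j) else 0)
      = of_real (1 / theta ^ level i) * tail A f (Suc (level i))"
    unfolding tail_def sum_distrib_left by (rule sum.inter_filter[OF assms, symmetric])
  ultimately show ?thesis by simp
qed

text \<open>The correction in \<open>sum_coeff\<close> has average exactly
  \<open>avg (Suc k) g\<close> on level \<open>k\<close>, because \<open>mu ^ k * theta ^ k\<close>
  is the block size; this makes sums over levels telescope.\<close>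

lemma avg_sum_coeff: "avg k (sum_coeff g) = avg k g - avg (Suc k) g"
proof -
  have "(\<Sum>i | level i = k. sum_coeff g i) = (\<Sum>i | level i
      = k. g i - of_real (1 / theta ^ k) * avg (Suc k) g)"
    by (intro sum.cong) (auto simp: sum_coeff_def)
  also have "\<dots> = (\<Sum>i | level i = k. g i) - of_real (2 ^ k / theta ^ k) * avg (Suc k) g"
    by (simp add: sum_subtractf card_level_eq)
  finally have "avg k (sum_coeff g) = avg k g - of_real (1 / mu ^ k) * (of_real (2 ^ k / theta ^ k)
      * avg (Suc k) g)"
    unfolding avg_def[of k] by (simp only: right_diff_distrib)
  also have "of_real (1 / mu ^ k) * (of_real (2 ^ k / theta ^ k) * avg (Suc k) g)
      = of_real (1 / mu ^ k * (2 ^ k / theta ^ k)) * avg (Suc k) g"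
    by (simp only: of_real_mult mult.assoc)
  also have "1 / mu ^ k * (2 ^ k / theta ^ k) = 1"
    using mu_mult_theta_power[of k] by simp
  finally show ?thesis by simp
qed

lemma sum_avg_sum_coeff: "k \<le> K \<Longrightarrow> (\<Sum>l=k..<K. avg l (sum_coeff g)) = avg k g - avg K g"
  by (induction K rule: dec_induct) (auto simp: avg_sum_coeff)

text \<open>The 6 is \<open>2 * (1 + 2)\<close>: the correction on level \<open>k\<close> uses the
  average on the next level, at most \<open>2 * M\<close>, and \<open>lq_sum_add\<close> doubles the
  total.\<close>

lemma lq_sum_sum_coeff:
  assumes "lq_sum {i. level i = k} g \<le> M powr q" and "lq_sum {i. level i = Suc k} g \<le> M powr q"
      and "0 < M"
  shows "lq_sum {i. level i = k} (sum_coeff g) \<le> (6 * M) powr q"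
proof -
  have "lq_sum {i. level i = k} (\<lambda>i. g i + (- of_real (1 / theta ^ level i) * avg (Suc (level i))
      g)) \<le> (2 * (M + 2 * M)) powr q"
  proof (rule lq_sum_add[OF assms(1)])
    show "lq_sum {i. level i = k} (\<lambda>i. - of_real (1 / theta ^ level i) * avg (Suc (level i)) g)
        \<le> (2 * M) powr q"
    proof (rule lq_sum_const[OF order_refl])
      show "norm (- of_real (1 / theta ^ level i) * avg (Suc (level i)) g) \<le> 2 * M / theta ^ k"
          if "i \<in> {i. level i = k}" for i
        using that divide_right_mono[OF norm_avg_le[OF assms(2,3)], of "theta ^ k"]
          unfolding norm_mult norm_minus_cancel norm_of_real by (simp add: abs_of_pos)
    qed (use assms in simp)
  qed (use assms in simp_all)
  moreover have "(\<lambda>i. g i + (- of_real (1 / theta ^ level i) * avg (Suc (level i)) g)) = sum_coeff g"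
    by (simp add: sum_coeff_def fun_eq_iff)
  ultimately show ?thesis by simp
qed

text \<open>Since the averages of \<open>sum_vec j\<close> agree on all levels up to
  \<open>level j\<close>, subtracting the average of the next level cancels exactly the constants
  added on the lower blocks.\<close>

lemma sum_coeff_sum_vec: "sum_coeff (sum_vec j :: nat \<Rightarrow> 'k::real_normed_field) i = (if i
    = j then 1 else 0)"
proof -
  have "avg k (sum_vec j :: nat \<Rightarrow> 'k) = (if k \<le> level j then of_real (1 / mu ^ level j) else 0)" for k
  proof -
    have S: "(\<Sum>i | level i = k. sum_vec j i :: 'k) = (if k = level j then 1 else 0)
        + (if k < level j then of_nat (2 ^ k) * of_real (1 / (mu ^ level j * theta ^ k)) else 0)"
    proof -
      have "(\<Sum>i | level i = k. sum_vec j i :: 'k) = (\<Sum>i | level i = k. if i = j then 1 else 0)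
        + (\<Sum>i | level i = k. if k < level j then of_real (1 / (mu ^ level j * theta ^ k)) else 0)"
        unfolding sum_vec_def sum.distrib[symmetric] by (intro sum.cong) auto
      then show ?thesis by (auto simp: card_level_eq)
    qed
    have E: "of_real (1 / mu ^ k) * (of_nat (2 ^ k) * of_real (1 / (mu ^ level j * theta ^ k)))
        = (of_real (1 / mu ^ level j) :: 'k)"
    proof -
      have "1 / mu ^ k * (2 ^ k * (1 / (mu ^ level j * theta ^ k))) = 1 / mu ^ level j"
        using mu_mult_theta_power[of k] by (simp add: field_simps)
      then have "(of_real (1 / mu ^ k * (2 ^ k * (1 / (mu ^ level j * theta ^ k)))) :: 'k)
          = of_real (1 / mu ^ level j)"
        by (simp only:)
      then show ?thesis
        by (simp only: of_real_mult of_real_power of_real_numeral of_nat_power of_nat_numeral)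
    qed
    show ?thesis
    proof (cases "k < level j")
      case True
      then have "(\<Sum>i | level i = k. sum_vec j i :: 'k)
          = of_nat (2 ^ k) * of_real (1 / (mu ^ level j * theta ^ k))"
        unfolding S by simp
      then show ?thesis using E True by (simp only: avg_def less_imp_le if_True)
    next
      case False
      then show ?thesis unfolding avg_def S by auto
    qed
  qed
  then show ?thesis by (auto simp: sum_coeff_def sum_vec_def Suc_le_eq)
qed

lemma lq_sum_sum_vec: "lq_sum {i. level i = k} (sum_vec j :: nat \<Rightarrow> 'k::real_normed_field) \<le> 1 powr q"
proof (cases "k = level j")
  case True
  have "lq_sum {i. level i = k} (sum_vec j :: nat \<Rightarrow> 'k) = (\<Sum>i | level i = k. if i = j then 1 else 0)"
    unfolding lq_sum_def by (intro sum.cong) (use True in \<open>auto simp: sum_vec_def\<close>)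
  then show ?thesis using True by simp
next
  case False
  show ?thesis
  proof (rule lq_sum_const[OF order_refl])
    fix i assume "i \<in> {i. level i = k}"
    moreover have "1 / (mu ^ level j * theta ^ k) \<le> 1 / theta ^ k"
      using mu_gt_1 by (intro divide_left_mono) (auto intro!: mult_pos_pos)
    ultimately show "norm (sum_vec j i :: 'k) \<le> 1 / theta ^ k"
      using False by (auto simp: sum_vec_def simp del: of_real_divide of_real_mult)
  qed simp
qed

lemma norm_le_of_lq_sum:
  assumes "lq_sum {i. level i = level j} g \<le> M powr q" and "0 \<le> M"
  shows "norm (g j) \<le> M"
proof -
  have "norm (g j) powr q \<le> M powr q"
    using assms(1) lq_sum_subset[of "{i. level i = level j}" "{j}" g] by (simp add: lq_sum_def)
  then show ?thesis
    using powr_less_mono2[of q M "norm (g j)"] assms(2) q_gt_1 by force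
qed

lemma norm_sum_coeff_le:
  assumes "\<And>k. lq_sum {i. level i = k} g \<le> M powr q" and "0 < M"
  shows "norm (sum_coeff g j) \<le> 3 * M"
proof -
  have "norm (g j) \<le> M" using norm_le_of_lq_sum[OF assms(1)] assms(2) by simp
  moreover have "norm (of_real (1 / theta ^ level j) * avg (Suc (level j)) g) \<le> 2 * M"
  proof -
    have "norm (of_real (1 / theta ^ level j) * avg (Suc (level j)) g) \<le> 1 * (2 * M)"
      unfolding norm_mult norm_of_real using norm_avg_le[OF assms(1,2)] theta_gt_1
      by (intro mult_mono) auto
    then show ?thesis by simp
  qed
  ultimately show ?thesis unfolding sum_coeff_def by (intro order_trans[OF norm_triangle_ineq4]) simp
qed

text \<open>The summands bound, in this order, the two ends of the telescoping sum, the small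
  coefficients off the greedy set below the critical level, and the geometric decay from that level
  on.\<close>

definition tail_const :: real where
  "tail_const = 4 + 4 * theta / (theta - 1) + 2 * mu / (mu - 1)"

lemma tail_const_nonneg: "0 \<le> tail_const"
  using theta_gt_1 mu_gt_1 by (simp add: tail_const_def)

lemma tail_by_levels:
  assumes "finite A" and "\<And>j. j \<in> A \<Longrightarrow> level j < n"
  shows "tail A f k = (\<Sum>l=k..<n. of_real (1 / mu ^ l) * (\<Sum>j | j \<in> A \<and> level j = l. f j))"
proof -
  have "tail A f k = (\<Sum>l=k..<n. \<Sum>j | j \<in> {j. j \<in> A \<and> k \<le> level j} \<and> level j
      = l. of_real (1 / mu ^ level j) * f j)"
    unfolding tail_def by (rule sum.group[symmetric]) (use assms in auto)
  also have "\<dots> = (\<Sum>l=k..<n. of_real (1 / mu ^ l) * (\<Sum>j | j \<in> A \<and> level j = l. f j))"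
    unfolding sum_distrib_left by (intro sum.cong) auto
  finally show ?thesis .
qed

lemma norm_correction_le:
  assumes "\<And>k. lq_sum {i. level i = k} g \<le> M powr q" and "0 < M"
  shows "norm (of_real (1 / theta ^ l) * avg m g) \<le> 2 * M / theta ^ l"
  unfolding norm_mult norm_of_real
  using divide_right_mono[OF norm_avg_le[OF assms(1)[of m] assms(2)], of "theta ^ l"] by simp

text \<open>Let \<open>t\<close> be the threshold of the greedy set \<open>A\<close>. In the levels \<open>l < K\<close> one removes from
  \<open>sum_coeff g\<close>, whose sums over levels telescope, the part off \<open>A\<close>, which is at most \<open>t\<close>. In the levels \<open>l \<ge> K\<close> the
  coefficients on \<open>A\<close> are comparable to \<open>g\<close>, and \<open>q > 1\<close> makes their contributions decay
  geometrically.\<close>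

lemma norm_tail_greedy_le:
  fixes g :: "nat \<Rightarrow> 'k::real_normed_field"
  assumes g: "\<And>k. lq_sum {i. level i = k} g \<le> M powr q" and M: "0 < M"
    and A: "finite A" and t: "0 < t"
    and above: "\<And>j. j \<in> A \<Longrightarrow> t \<le> norm (sum_coeff g j)"
    and below: "\<And>j. j \<notin> A \<Longrightarrow> norm (sum_coeff g j) \<le> t"
  shows "norm (tail A (sum_coeff g) k) \<le> tail_const * M"
proof -
  \<comment> \<open>The 4 makes the correction \<open>2 * M / theta ^ l\<close> at most
    \<open>t / 2\<close> from level \<open>K\<close> on, so that \<open>g\<close> itself is at least
    \<open>t / 2\<close> on \<open>A\<close> there. Minimality gives
    \<open>theta ^ K \<le> theta * (4 * M / t)\<close> when \<open>0 < K\<close>, which closes the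
    geometric sum below \<open>K\<close>.\<close>
  define K where "K = (LEAST K. 4 * M / t \<le> theta ^ K)"
  have "\<exists>K. 4 * M / t \<le> theta ^ K" using real_arch_pow[OF theta_gt_1] less_imp_le by blast
  then have K: "4 * M / t \<le> theta ^ K" unfolding K_def by (rule LeastI_ex)
  have K_min: "theta ^ l < 4 * M / t" if "l < K" for l
    using not_less_Least[of l "\<lambda>K. 4 * M / t \<le> theta ^ K"] that by (simp add: K_def)
  obtain n0 where n0: "\<And>j. j \<in> A \<Longrightarrow> level j < n0"
    using finite_nat_bounded[of "level ` A"] A by (auto simp: subset_iff)
  define p where "p = max k K"
  define n where "n = max n0 p"
  define w where "w l = of_real (1 / mu ^ l) * (\<Sum>j | j \<in> A \<and> level j = l. sum_coeff g j)" for l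
  have kp: "k \<le> p" and Kp: "K \<le> p" and pn: "p \<le> n" by (simp_all add: p_def n_def)
  have "tail A (sum_coeff g) k = (\<Sum>l=k..<n. w l)"
    unfolding w_def using tail_by_levels[OF A, of n] n0 by (simp add: n_def less_max_iff_disj)
  also have "\<dots> = (\<Sum>l=k..<p. w l) + (\<Sum>l=p..<n. w l)"
    using kp pn by (simp add: sum.atLeastLessThan_concat)
  finally have split: "tail A (sum_coeff g) k = (\<Sum>l=k..<p. w l) + (\<Sum>l=p..<n. w l)" .

  define h where "h j = (if j \<in> A then 0 else sum_coeff g j)" for j
  have w_eq: "w l = avg l (sum_coeff g) - avg l h" for l
  proof -
    have "(\<Sum>j | level j = l. sum_coeff g j) = (\<Sum>j | level j = l.
        if j \<in> A then sum_coeff g j else 0) + (\<Sum>j | level j = l. h j)"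
      unfolding sum.distrib[symmetric] by (intro sum.cong) (auto simp: h_def)
    moreover have "(\<Sum>j | level j = l. if j \<in> A then sum_coeff g j else 0) = (\<Sum>j | j \<in> A \<and> level j
        = l. sum_coeff g j)"
      by (subst sum.inter_filter[symmetric]) (auto intro!: sum.cong)
    ultimately show ?thesis unfolding w_def avg_def by (simp add: algebra_simps)
  qed
  have avg_h: "norm (avg l h) \<le> t * theta ^ l" for l
  proof -
    have "norm (\<Sum>j | level j = l. h j) \<le> (\<Sum>j | level j = l. t)"
      by (rule sum_norm_le) (use below t in \<open>auto simp: h_def\<close>)
    then have "norm (\<Sum>j | level j = l. h j) \<le> (mu ^ l * theta ^ l) * t"
      by (simp add: card_level_eq mu_mult_theta_power)
    then show ?thesis unfolding avg_def norm_mult norm_of_real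
      by (simp add: divide_le_eq mult_ac)
  qed
  have sum_h: "(\<Sum>l=k..<p. t * theta ^ l) \<le> 4 * theta / (theta - 1) * M"
  proof (cases "k < K")
    case False
    then have "p = k" by (simp add: p_def)
    then show ?thesis using theta_gt_1 M by simp
  next
    case True
    then have pK: "p = K" by (simp add: p_def)
    have "(\<Sum>l=k..<p. t * theta ^ l) \<le> (\<Sum>l<K. t * theta ^ l)"
      unfolding pK by (rule sum_mono2) (use t in auto)
    also have "\<dots> = t * ((theta ^ K - 1) / (theta - 1))"
      using geometric_sum[of theta K] theta_gt_1 by (simp add: sum_distrib_left[symmetric])
    also have "\<dots> \<le> t * (theta ^ K / (theta - 1))"
      using t theta_gt_1 by (intro mult_left_mono divide_right_mono) auto
    also have "\<dots> \<le> t * (theta * (4 * M / t) / (theta - 1))"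
    proof -
      obtain K' where K': "K = Suc K'" using True by (cases K) auto
      have "theta ^ K \<le> theta * (4 * M / t)"
        using mult_left_mono[OF less_imp_le[OF K_min[of K']], of theta] K' by simp
      then show ?thesis using t theta_gt_1 by (intro mult_left_mono divide_right_mono) auto
    qed
    also have "\<dots> = 4 * theta / (theta - 1) * M" using t by simp
    finally show ?thesis .
  qed
  have first: "norm (\<Sum>l=k..<p. w l) \<le> 4 * M + 4 * theta / (theta - 1) * M"
  proof -
    have "(\<Sum>l=k..<p. w l) = (avg k g - avg p g) - (\<Sum>l=k..<p. avg l h)"
      unfolding w_eq sum_subtractf sum_avg_sum_coeff[OF kp] ..
    moreover have "norm (avg k g - avg p g) \<le> 2 * M + 2 * M"
      by (intro norm_triangle_le_diff add_mono norm_avg_le g M)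
    moreover have "norm (\<Sum>l=k..<p. avg l h) \<le> 4 * theta / (theta - 1) * M"
      by (intro order_trans[OF sum_norm_le sum_h] avg_h)
    ultimately show ?thesis
      using norm_triangle_ineq4[of "avg k g - avg p g" "\<Sum>l=k..<p. avg l h"] by simp
  qed

  have big: "norm (w l) \<le> 2 * M * (1 / mu) ^ (l - K)" if l: "K \<le> l" for l
  proof -
    let ?B = "{j. j \<in> A \<and> level j = l}"
    have small: "2 * M / theta ^ l \<le> t / 2"
    proof -
      have "4 * M / t \<le> theta ^ l" using K power_increasing[OF l, of theta] theta_gt_1 by linarith
      then have "4 * M \<le> theta ^ l * t" using t by (simp add: divide_le_eq)
      then show ?thesis by (simp add: divide_le_eq field_simps)
    qed
    have pt: "norm (sum_coeff g j) \<le> 2 * ((t / 2) powr (1 - q) * norm (g j) powr q)" if "j \<in> ?B" for j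
    proof -
      have d: "norm (sum_coeff g j - g j) \<le> t / 2"
        using norm_correction_le[OF g M, of "level j" "Suc (level j)"] that small
            by (simp add: sum_coeff_def)
      have lo: "t / 2 \<le> norm (g j)"
        using above[of j] that d norm_triangle_ineq2[of "sum_coeff g j" "g j"] by simp
      have "norm (sum_coeff g j) \<le> 2 * norm (g j)"
        using lo d norm_triangle_ineq2[of "sum_coeff g j" "g j"] by simp
      then show ?thesis using le_powr_of_ge[of "t / 2" "norm (g j)"] lo t by simp
    qed
    have "lq_sum ?B g \<le> M powr q"
      using lq_sum_subset[of "{i. level i = l}" ?B g] g[of l] by force
    moreover have "norm (\<Sum>j\<in>?B. sum_coeff g j) \<le> (\<Sum>j\<in>?B. 2 * ((t / 2) powr (1 - q) * norm (g j)
        powr q))"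
      by (rule sum_norm_le) (use pt in blast)
    moreover have "(\<Sum>j\<in>?B. 2 * ((t / 2) powr (1 - q) * norm (g j) powr q))
        = 2 * ((t / 2) powr (1 - q) * lq_sum ?B g)"
      by (simp add: lq_sum_def sum_distrib_left)
    ultimately have "norm (\<Sum>j\<in>?B. sum_coeff g j) \<le> 2 * ((t / 2) powr (1 - q) * M powr q)"
      by (smt (verit) mult_left_mono powr_ge_zero)
    also have "(t / 2) powr (1 - q) * M powr q = M * (2 * M / t) powr (q - 1)"
    proof -
      have "M powr q = M * M powr (q - 1)" using powr_mult_base[of M "q - 1"] M by simp
      moreover have "(t / 2) powr (1 - q) = 1 / (t / 2) powr (q - 1)"
        using powr_minus_divide[of "t / 2" "q - 1"] by simp
      moreover have "(2 * M / t) powr (q - 1) = M powr (q - 1) / (t / 2) powr (q - 1)"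
      proof -
        have "2 * M / t = M / (t / 2)" by simp
        then show ?thesis by (simp only: powr_divide)
      qed
      ultimately show ?thesis by simp
    qed
    \<comment> \<open>The choice of \<open>K\<close> turns the power into \<open>mu ^ K\<close>;
      division by \<open>mu ^ l\<close> then leaves the decay
      \<open>(1 / mu) ^ (l - K)\<close>.\<close>
    also have "2 * (M * (2 * M / t) powr (q - 1)) \<le> 2 * (M * mu ^ K)"
    proof -
      have "2 * M / t \<le> theta ^ K" using K M t by (simp add: divide_le_eq)
      then have "(2 * M / t) powr (q - 1) \<le> (theta ^ K) powr (q - 1)"
        using q_gt_1 M t by (intro powr_mono2) auto
      then show ?thesis using M by (simp add: theta_power_powr')
    qed
    finally have "norm (w l) \<le> 1 / mu ^ l * (2 * (M * mu ^ K))"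
      unfolding w_def norm_mult norm_of_real by (simp add: divide_right_mono)
    moreover have "mu ^ l = mu ^ K * mu ^ (l - K)" using l by (simp flip: power_add)
    ultimately show ?thesis by (simp add: power_divide)
  qed
  have second: "norm (\<Sum>l=p..<n. w l) \<le> 2 * mu / (mu - 1) * M"
  proof -
    have r: "0 < 1 / mu" "1 / mu < 1" using mu_gt_1 by auto
    have "norm (\<Sum>l=p..<n. w l) \<le> (\<Sum>l=p..<n. 2 * M * (1 / mu) ^ (l - K))"
      by (rule sum_norm_le) (use big Kp in auto)
    also have "\<dots> \<le> (\<Sum>l=K..<n. 2 * M * (1 / mu) ^ (l - K))"
      by (rule sum_mono2) (use Kp M in auto)
    also have "\<dots> = (\<Sum>i<n - K. 2 * M * (1 / mu) ^ i)"
      by (rule sum.reindex_bij_witness[of _ "\<lambda>i. i + K" "\<lambda>l. l - K"]) auto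
    also have "\<dots> = 2 * M * (((1 / mu) ^ (n - K) - 1) / (1 / mu - 1))"
      using geometric_sum[of "1 / mu" "n - K"] r by (simp add: sum_distrib_left[symmetric])
    also have "((1 / mu) ^ (n - K) - 1) / (1 / mu - 1) = (1 - (1 / mu) ^ (n - K)) / (1 - 1 / mu)"
      using minus_divide_divide[of "1 - (1 / mu) ^ (n - K)" "1 - 1 / mu"] by simp
    also have "2 * M * ((1 - (1 / mu) ^ (n - K)) / (1 - 1 / mu)) \<le> 2 * M * (1 / (1 - 1 / mu))"
      using r M by (intro mult_left_mono divide_right_mono) auto
    also have "\<dots> = 2 * mu / (mu - 1) * M" using mu_gt_1 by (simp add: field_simps)
    finally show ?thesis .
  qed
  show ?thesis
    unfolding split using norm_triangle_le[OF add_mono[OF first second]]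
    by (simp add: tail_const_def algebra_simps)
qed

lemma lq_sum_synth:
  assumes "finite A" and "lq_sum {i. level i = k} f \<le> N powr q" and "0 \<le> N"
    and "norm (tail A f (Suc k)) \<le> c" and "0 \<le> c"
  shows "lq_sum {i. level i = k} (synth A f) \<le> (2 * (N + c)) powr q"
proof -
  have "lq_sum {i. level i = k} (\<lambda>i. if i \<in> A then f i else 0) \<le> (1 * N) powr q"
    by (rule lq_sum_mono_dom[OF _ _ _ assms(2)]) (use assms in auto)
  moreover have "lq_sum {i. level i = k} (\<lambda>i. of_real (1 / theta ^ level i) * tail A f (Suc (level
      i))) \<le> c powr q"
  proof (rule lq_sum_const[OF order_refl _ assms(5)])
    fix i assume "i \<in> {i. level i = k}"
    then show "norm (of_real (1 / theta ^ level i) * tail A f (Suc (level i))) \<le> c / theta ^ k"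
      unfolding norm_mult norm_of_real using divide_right_mono[OF assms(4), of "theta ^ k"] by simp
  qed
  ultimately show ?thesis
    using lq_sum_add[of "{i. level i = k}" "\<lambda>i. if i \<in> A then f i else 0" N _ c] assms
    by (simp add: synth_eq[OF assms(1), abs_def])
qed

lemma lq_sum_greedy:
  fixes g :: "nat \<Rightarrow> 'k::real_normed_field"
  assumes g: "\<And>k. lq_sum {i. level i = k} g \<le> M powr q" and M: "0 < M" and A: "finite A"
    and greedy: "\<And>j k. j \<notin> A \<Longrightarrow> k \<in> A \<Longrightarrow> norm (sum_coeff g j) \<le> norm (sum_coeff g k)"
  shows "lq_sum {i. level i = k} (synth A (sum_coeff g)) \<le> (2 * (6 + tail_const) * M) powr q"
proof -
  \<comment> \<open>Zero coefficients do not change the sum; without them the smallest modulus on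
    the set is a positive threshold.\<close>
  define A' where "A' = {j \<in> A. sum_coeff g j \<noteq> 0}"
  have finA': "finite A'" using A by (simp add: A'_def)
  have synth: "synth A' (sum_coeff g) = synth A (sum_coeff g)"
    unfolding synth_def by (intro ext sum.mono_neutral_left) (auto simp: A'_def A)
  have "norm (tail A' (sum_coeff g) (Suc k)) \<le> tail_const * M"
  proof (cases "A' = {}")
    case True
    then show ?thesis using tail_const_nonneg M by (simp add: tail_def)
  next
    case False
    define t where "t = Min ((\<lambda>j. norm (sum_coeff g j)) ` A')"
    have t_le: "t \<le> norm (sum_coeff g j)" if "j \<in> A'" for j
      using that finA' by (simp add: t_def)
    have "t \<in> (\<lambda>j. norm (sum_coeff g j)) ` A'" unfolding t_def
        by (rule Min_in) (use finA' False in auto)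
    then obtain i where i: "i \<in> A'" "t = norm (sum_coeff g i)" by auto
    show ?thesis
    proof (rule norm_tail_greedy_le[OF g M finA' _ t_le])
      show "0 < t" using i by (simp add: A'_def)
      show "norm (sum_coeff g j) \<le> t" if "j \<notin> A'" for j
        using that i greedy[of j i] by (cases "j \<in> A") (auto simp: A'_def)
    qed
  qed
  then have "lq_sum {i. level i = k} (synth A' (sum_coeff g)) \<le> (2 * (6 * M + tail_const * M)) powr q"
    by (intro lq_sum_synth finA' lq_sum_sum_coeff g M) (use M tail_const_nonneg in simp_all)
  then show ?thesis by (simp add: synth algebra_simps)
qed

text \<open>The indices below \<open>n\<close> fill the levels below \<open>m = level n\<close>, a
  part of level \<open>m\<close> and nothing beyond. Below \<open>m\<close> telescoping leaves
  constants of size \<open>2 * e + 12 * e\<close>, on level \<open>m\<close> the bound is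
  \<open>2 * (e + 6 * e)\<close>, and beyond \<open>g\<close> is unchanged; hence the 14.\<close>

lemma lq_sum_remainder:
  fixes g :: "nat \<Rightarrow> 'k::real_normed_field"
  assumes g: "\<And>k. K \<le> k \<Longrightarrow> lq_sum {i. level i = k} g \<le> e powr q" and e: "0 < e" and n: "K \<le> level n"
  shows "lq_sum {i. level i = k} (\<lambda>i. g i - synth {..<n} (sum_coeff g) i) \<le> (14 * e) powr q"
proof -
  define m where "m = level n"
  \<comment> \<open>What the incomplete level contributes to all lower tails.\<close>
  define d where "d = of_real (1 / mu ^ m) * (\<Sum>j | j < n \<and> level j = m. sum_coeff g j)"
  have gm: "lq_sum {i. level i = l} g \<le> e powr q" if "m \<le> l" for l
    using g[of l] that n by (simp add: m_def)
  have cfm: "lq_sum {i. level i = m} (sum_coeff g) \<le> (6 * e) powr q"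
    by (intro lq_sum_sum_coeff gm e) simp_all
  have level_lt: "j < n" if "level j < m" for j
    using that level_mono[of n j] by (force simp: m_def)
  have d: "norm d \<le> 12 * e"
  proof -
    have "lq_sum {j. j < n \<and> level j = m} (sum_coeff g) \<le> lq_sum {j. level j = m} (sum_coeff g)"
      by (rule lq_sum_subset) auto
    then have "(\<Sum>j | j < n \<and> level j = m. norm (sum_coeff g j)) \<le> 2 * (6 * e) * mu ^ m"
      by (intro level_sum_norm_le) (use cfm e in auto)
    then have "norm (\<Sum>j | j < n \<and> level j = m. sum_coeff g j) \<le> 12 * e * mu ^ m"
      using norm_sum[of "sum_coeff g" "{j. j < n \<and> level j = m}"] by linarith
    then show ?thesis unfolding d_def norm_mult norm_of_real by (simp add: divide_le_eq)
  qed
  have tail_lt: "tail {..<n} (sum_coeff g) k = avg k g - avg m g + d" if "k \<le> m" for k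
  proof -
    have "tail {..<n} (sum_coeff g) k = (\<Sum>l=k..<Suc m. of_real (1 / mu ^ l) * (\<Sum>j | j \<in> {..<n}
        \<and> level j = l. sum_coeff g j))"
      by (rule tail_by_levels) (use level_mono in \<open>auto simp: m_def less_Suc_eq_le\<close>)
    also have "\<dots> = (\<Sum>l=k..<m. of_real (1 / mu ^ l) * (\<Sum>j | j \<in> {..<n} \<and> level j
        = l. sum_coeff g j)) + d"
      using that by (simp add: d_def)
    also have "(\<Sum>l=k..<m. of_real (1 / mu ^ l) * (\<Sum>j | j \<in> {..<n} \<and> level j = l. sum_coeff g j))
        = (\<Sum>l=k..<m. avg l (sum_coeff g))"
    proof (rule sum.cong)
      fix l assume "l \<in> {k..<m}"
      then have "{j. j \<in> {..<n} \<and> level j = l} = {j. level j = l}" using level_lt by auto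
      then show "of_real (1 / mu ^ l) * (\<Sum>j | j \<in> {..<n} \<and> level j = l. sum_coeff g j)
          = avg l (sum_coeff g)"
        by (simp add: avg_def)
    qed simp
    finally show ?thesis using sum_avg_sum_coeff[OF that] by simp
  qed
  have tail_ge: "tail {..<n} (sum_coeff g) k = 0" if "m < k" for k
  proof -
    have "level j < k" if "j < n" for j
      using level_mono[of j n] that \<open>m < k\<close> by (simp add: m_def)
    then have "{j. j \<in> {..<n} \<and> k \<le> level j} = {}" by (auto simp: not_le)
    then show ?thesis unfolding tail_def by (simp only: sum.empty)
  qed
  consider "k < m" | "k = m" | "m < k" by linarith
  then show ?thesis
  proof cases
    case 1
    show ?thesis
    proof (rule lq_sum_const[OF order_refl])
      fix i assume i: "i \<in> {i. level i = k}"
      have "g i - synth {..<n} (sum_coeff g) i = of_real (1 / theta ^ k) * (avg m g - d)"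
        using i 1 level_lt[of i] by (simp add: synth_eq tail_lt sum_coeff_def algebra_simps
            diff_divide_distrib add_divide_distrib)
      moreover have le: "norm (avg m g - d) \<le> 14 * e"
        using norm_triangle_ineq4[of "avg m g" d] norm_avg_le[OF gm[OF order_refl] e] d by linarith
      ultimately show "norm (g i - synth {..<n} (sum_coeff g) i) \<le> 14 * e / theta ^ k"
        unfolding norm_mult norm_of_real using divide_right_mono[OF le, of "theta ^ k"]
        by (simp only: norm_mult norm_of_real) simp
    qed (use e in simp)
  next
    case 2
    have "lq_sum {i. level i = m} (\<lambda>i. if i < n then - sum_coeff g i else 0) \<le> (1 * (6 * e)) powr q"
      by (rule lq_sum_mono_dom[OF _ _ _ cfm]) (use e in auto)
    then have "lq_sum {i. level i = m} (\<lambda>i. g i + (if i < n then - sum_coeff g i else 0))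
        \<le> (2 * (e + 1 * (6 * e))) powr q"
      by (intro lq_sum_add gm) (use e in auto)
    moreover have "lq_sum {i. level i = m} (\<lambda>i. g i + (if i < n then - sum_coeff g i else 0))
        = lq_sum {i. level i = m} (\<lambda>i. g i - synth {..<n} (sum_coeff g) i)"
      unfolding lq_sum_def by (intro sum.cong) (auto simp: synth_eq tail_ge)
    ultimately show ?thesis using 2 by simp
  next
    case 3
    have "lq_sum {i. level i = k} (\<lambda>i. g i - synth {..<n} (sum_coeff g) i) \<le> (1 * e) powr q"
    proof (rule lq_sum_mono_dom)
      show "lq_sum {i. level i = k} g \<le> e powr q" by (rule gm) (use 3 in simp)
      fix i assume i: "i \<in> {i. level i = k}"
      then have "\<not> i < n" using 3 level_mono[of i n] by (force simp: m_def)
      then show "norm (g i - synth {..<n} (sum_coeff g) i) \<le> 1 * norm (g i)"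
        using i 3 by (simp add: synth_eq tail_ge)
    qed (use e in simp_all)
    also have "\<dots> \<le> (14 * e) powr q" using e q_gt_1 by (intro powr_mono2) auto
    finally show ?thesis .
  qed
qed

text \<open>Scaled so that level \<open>l\<close> contributes \<open>(- 1) ^ l\<close> to the tails.
  This is the usual witness for the summing basis: alternating sums stay bounded, the even terms
  alone do not.\<close>

definition alternating :: "nat \<Rightarrow> 'k::real_normed_field" where
  "alternating j = of_real ((- 1) ^ level j / theta ^ level j)"

text \<open>The third hypothesis makes \<open>A\<close> a union of full levels, so each level
  contributes either its whole sum or nothing.\<close>

lemma tail_alternating:
  fixes n k :: nat
  assumes "finite A" and "\<And>j. j \<in> A \<Longrightarrow> level j < n"
    and "\<And>i j. level i = level j \<Longrightarrow> i \<in> A \<Longrightarrow> j \<in> A"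
  shows "(tail A alternating k :: 'k::real_normed_field) = of_real (\<Sum>l=k..<n. if {j. level j
      = l} \<subseteq> A then (- 1) ^ l else 0)"
proof -
  have lvl: "of_real (1 / mu ^ l) * (\<Sum>j | j \<in> A \<and> level j = l. alternating j)
      = (of_real (if {j. level j = l} \<subseteq> A then (- 1) ^ l else 0) ::'k)" for l
  proof (cases "{j. level j = l} \<subseteq> A")
    case True
    then have "{j. j \<in> A \<and> level j = l} = {j. level j = l}" by auto
    then have "(\<Sum>j | j \<in> A \<and> level j = l. alternating j ::'k) = (\<Sum>j | level j
        = l. of_real ((- 1) ^ l / theta ^ l))"
      by (auto intro!: sum.cong simp: alternating_def)
    also have "\<dots> = of_real (2 ^ l * ((- 1) ^ l / theta ^ l))" by (simp add: card_level_eq)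
    also have "of_real (1 / mu ^ l) * \<dots> = (of_real (1 / mu ^ l * (2 ^ l * ((- 1) ^ l / theta ^ l)))
        ::'k)"
      by (simp only: of_real_mult)
    also have "1 / mu ^ l * (2 ^ l * ((- 1) ^ l / theta ^ l)) = (- 1) ^ l"
      using mu_mult_theta_power[of l] by (simp add: field_simps)
    finally show ?thesis using True by simp
  next
    case False
    then obtain i where i: "level i = l" "i \<notin> A" by auto
    have "j \<notin> A" if "level j = l" for j using assms(3)[of j i] that i by auto
    then have "{j. j \<in> A \<and> level j = l} = {}" by auto
    then show ?thesis using False by (simp only: sum.empty) simp
  qed
  have "tail A alternating k = (\<Sum>l=k..<n. of_real (1 / mu ^ l) * (\<Sum>j | j \<in> A \<and> level j
      = l. alternating j ::'k))"
    by (rule tail_by_levels) (use assms(1,2) in auto)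
  then show ?thesis by (simp only: lvl of_real_sum)
qed

lemma alternating_sum_le_1: "\<bar>\<Sum>l=k..<n. (- 1) ^ l :: real\<bar> \<le> 1"
proof (cases "k \<le> n")
  case True
  then have "(\<Sum>l=k..<n. (- 1) ^ l :: real) = (if even (n - k) then 0 else (- 1) ^ k)"
  proof (induction n rule: dec_induct)
    case (step n)
    then show ?case by (auto simp: Suc_diff_le minus_one_power_iff)
  qed simp
  then show ?thesis by (simp add: minus_one_power_iff)
qed simp

text \<open>One unit for the coordinates themselves and one for the added constants, whose
  alternating tails are at most 1 in modulus.\<close>

lemma lq_sum_synth_alternating:
  "lq_sum {i. level i = k} (synth {j. level j < n} alternating :: nat \<Rightarrow> 'k::real_normed_field)
      \<le> 2 powr q"
proof (rule lq_sum_const[OF order_refl])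
  fix i assume i: "i \<in> {i. level i = k}"
  have "tail {j. level j < n} alternating (Suc k) = (of_real (\<Sum>l=Suc k..<n. if {j. level j
      = l} \<subseteq> {j. level j < n} then (- 1) ^ l else 0) :: 'k)"
    by (rule tail_alternating) auto
  also have "(\<Sum>l=Suc k..<n. if {j. level j = l} \<subseteq> {j. level j < n} then (- 1) ^ l else 0 :: real)
      = (\<Sum>l=Suc k..<n. (- 1) ^ l)"
    by (intro sum.cong) auto
  finally have tl: "norm (tail {j. level j < n} alternating (Suc k) :: 'k) \<le> 1"
    using alternating_sum_le_1[of "Suc k" n] by (simp only: norm_of_real)
  have "norm (if i \<in> {j. level j < n} then alternating i else 0 :: 'k) \<le> 1 / theta ^ k"
    using i by (simp add: alternating_def norm_divide norm_power)
  moreover have "norm (of_real (1 / theta ^ k) * tail {j. level j < n} alternating (Suc k) :: 'k)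
      \<le> 1 / theta ^ k"
    using divide_right_mono[OF tl, of "theta ^ k"] unfolding norm_mult norm_of_real by simp
  ultimately show "norm (synth {j. level j < n} alternating i :: 'k) \<le> 2 / theta ^ k"
    using i norm_triangle_ineq[of "if i \<in> {j. level j < n} then alternating i else 0 :: 'k"
      "of_real (1 / theta ^ k) * tail {j. level j < n} alternating (Suc k)"]
    by (simp add: synth_eq)
qed simp

text \<open>Index 0 is all of level 0, the lowest one, so every even level below \<open>n\<close>
  adds 1 to this coordinate. A single large coordinate is enough for a lower bound of the
  norm.\<close>

lemma synth_alternating_even_0:
  "real n / 2 \<le> norm (synth {j. level j < n \<and> even (level j)} alternating 0 :: 'k::real_normed_field)"
proof (cases n)
  case (Suc n')
  let ?A = "{j. level j < n \<and> even (level j)}"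
  have fin: "finite ?A" by (rule finite_subset[OF _ finite_level_less[of n]]) auto
  have sub: "{j. level j = l} \<subseteq> ?A \<longleftrightarrow> l < n \<and> even l" for l
  proof -
    obtain i where l: "level i = l" using level_eq_iff[of "2 ^ l - 1" l] by auto
    show ?thesis
    proof
      assume "{j. level j = l} \<subseteq> ?A"
      then have "i \<in> ?A" by (rule subsetD) (simp add: l)
      then show "l < n \<and> even l" by (simp add: l)
    qed auto
  qed
  have alternating_0: "alternating 0 = (1 :: 'k)" by (simp add: alternating_def)
  have count: "(\<Sum>l<m. if even l then 1 else 0 :: real) = (real m + of_bool (odd m)) / 2" for m
    by (induction m) auto
  have "tail ?A alternating 1 = (of_real (\<Sum>l=1..<n. if {j. level j
      = l} \<subseteq> ?A then (- 1) ^ l else 0) :: 'k)"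
    by (rule tail_alternating) (use fin in auto)
  also have "(\<Sum>l=1..<n. if {j. level j = l} \<subseteq> ?A then (- 1) ^ l else 0 :: real) = (\<Sum>l=1..<n.
      if even l then 1 else 0)"
    unfolding sub by (intro sum.cong) auto
  finally have tail: "tail ?A alternating 1 = (of_real (\<Sum>l=1..<n. if even l then 1 else 0) :: 'k)" .
  have "synth ?A alternating 0 = (1 + tail ?A alternating 1 :: 'k)"
    unfolding synth_eq[OF fin] using Suc by (simp add: alternating_0)
  also have "\<dots> = of_real (1 + (\<Sum>l=1..<n. if even l then 1 else 0))"
    unfolding tail of_real_add of_real_1 ..
  also have "1 + (\<Sum>l=1..<n. if even l then 1 else 0) = (\<Sum>l<n. if even l then 1 else 0 :: real)"
    unfolding lessThan_atLeast0 by (subst sum.atLeast_Suc_lessThan[of 0 n]) (use Suc in simp_all)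
  finally have eq: "synth ?A alternating 0 = (of_real (\<Sum>l<n. if even l then 1 else 0) :: 'k)" .
  show ?thesis unfolding eq count norm_of_real by simp
qed simp

end

section \<open>Splitting the rows of the c0-sum\<close>

text \<open>The numbers 0, 1, 3, 7, ..., each twice its predecessor plus one. Placing every row of
  such a length \<open>n\<close> into the next one leaves \<open>n + 1\<close> entries free, a power
  of 2, while all other rows stay in place.\<close>

definition mersenne :: "nat \<Rightarrow> bool" where "mersenne n \<longleftrightarrow> (\<exists>k. Suc n = 2 ^ k)"

definition mersenne_row :: "nat \<Rightarrow> nat" where "mersenne_row k = 2 ^ Suc k - 1"

lemma Suc_mersenne_row: "Suc (mersenne_row k) = 2 ^ Suc k"
  by (simp add: mersenne_row_def)

lemma mersenne_mersenne_row: "mersenne (mersenne_row k)"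
  unfolding mersenne_def using Suc_mersenne_row by blast

lemma mersenne_row_half: "mersenne_row k div 2 = 2 ^ k - 1" and mersenne_row_odd: "mersenne_row k
    = Suc (2 * (mersenne_row k div 2))"
proof -
  have "(1::nat) \<le> 2 ^ k" by simp
  then have eq: "mersenne_row k = Suc (2 * (2 ^ k - 1))" unfolding mersenne_row_def power_Suc
      by linarith
  then show half: "mersenne_row k div 2 = 2 ^ k - 1" by simp
  show "mersenne_row k = Suc (2 * (mersenne_row k div 2))" unfolding half by (rule eq)
qed

lemma mersenne_cases:
  assumes "mersenne n"
  obtains "n = 0" | k where "n = mersenne_row k"
proof -
  obtain k where k: "Suc n = 2 ^ k" using assms by (auto simp: mersenne_def)
  show thesis
  proof (cases k)
    case 0
    then show thesis using k that(1) by simp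
  next
    case (Suc k')
    then show thesis using k that(2)[of k'] Suc_mersenne_row[of k'] by simp
  qed
qed

lemma mersenne_half:
  assumes "mersenne n"
  shows "mersenne (n div 2)"
  using assms
proof (cases rule: mersenne_cases)
  case 1
  then show ?thesis using assms by simp
next
  case (2 k)
  then have "Suc (n div 2) = 2 ^ k" by (simp add: mersenne_row_half)
  then show ?thesis unfolding mersenne_def by blast
qed

lemma mersenne_double: "mersenne n \<Longrightarrow> mersenne (Suc (2 * n))"
proof -
  assume "mersenne n"
  then obtain k where "Suc n = 2 ^ k" by (auto simp: mersenne_def)
  then have "Suc (Suc (2 * n)) = 2 ^ Suc k" by simp
  then show ?thesis unfolding mersenne_def by blast
qed

lemma level_eq_mersenne_row: "level j = k \<longleftrightarrow> mersenne_row k div 2 \<le> j \<and> j < mersenne_row k"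
  unfolding mersenne_row_half using levels_eq_atLeastLessThan[of k]
      by (auto simp: mersenne_row_def set_eq_iff)

text \<open>The row of length \<open>2 ^ Suc k - 1\<close> of \<open>B_{q,0}\<close> is cut into its first \<open>2 ^ k - 1\<close> entries, which
  serve as the row of that shorter length of a copy of \<open>B_{q,0}\<close>, and its last \<open>2 ^ k\<close> entries, whose
  positions are the numbers of level \<open>k\<close>.\<close>

definition row_embed :: "(nat \<Rightarrow> nat \<Rightarrow> 'k::zero) \<Rightarrow> nat \<Rightarrow> nat \<Rightarrow> 'k" where
  "row_embed v n i = (if mersenne n then if i < n div 2 then v (n div 2) i else 0 else v n i)"

definition row_retract :: "(nat \<Rightarrow> nat \<Rightarrow> 'k::zero) \<Rightarrow> nat \<Rightarrow> nat \<Rightarrow> 'k" where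
  "row_retract v n i = (if mersenne n then if i < n then v (Suc (2 * n)) i else 0 else v n i)"

definition block_part :: "(nat \<Rightarrow> nat \<Rightarrow> 'k::zero) \<Rightarrow> nat \<Rightarrow> 'k" where
  "block_part v j = v (mersenne_row (level j)) j"

definition block_embed :: "(nat \<Rightarrow> 'k::zero) \<Rightarrow> nat \<Rightarrow> nat \<Rightarrow> 'k" where
  "block_embed g n i = (if mersenne n \<and> n div 2 \<le> i \<and> i < n then g i else 0)"

lemma row_retract_row_embed:
  assumes "\<And>n i. n \<le> i \<Longrightarrow> v n i = 0"
  shows "row_retract (row_embed v) = v"
  by (intro ext) (auto simp: row_retract_def row_embed_def mersenne_double not_less assms)

lemma row_retract_block_embed: "row_retract (block_embed g) = (\<lambda>n i. 0)"
  by (intro ext) (auto simp: row_retract_def block_embed_def)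

lemma block_part_row_embed: "block_part (row_embed v) = (\<lambda>j. 0)"
proof
  fix j
  have "mersenne_row (level j) div 2 \<le> j" using level_eq_mersenne_row[of j "level j"] by simp
  then show "block_part (row_embed v) j = 0" by (simp add: block_part_def row_embed_def
      mersenne_mersenne_row)
qed

lemma block_part_block_embed: "block_part (block_embed g) = g"
proof
  fix j
  have "mersenne_row (level j) div 2 \<le> j \<and> j < mersenne_row (level j)"
      using level_eq_mersenne_row[of j "level j"] by simp
  then show "block_part (block_embed g) j = g j"
      by (simp add: block_part_def block_embed_def mersenne_mersenne_row)
qed

lemma block_part_add: "block_part (\<lambda>n i. v n i + w n i) = (\<lambda>i. block_part v i + block_part w i)"
  and block_part_scale: "block_part (\<lambda>n i. c * v' n i) = (\<lambda>i. c * block_part v' i)"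
  by (simp_all add: block_part_def fun_eq_iff)

lemma row_embed_row_retract_block_embed_block_part:
  fixes v :: "nat \<Rightarrow> nat \<Rightarrow> 'k::comm_monoid_add"
  assumes pad: "\<And>n i. n \<le> i \<Longrightarrow> v n i = 0"
  shows "row_embed (row_retract v) n i + block_embed (block_part v) n i = v n i"
proof (cases "mersenne n")
  case False
  then show ?thesis by (simp add: row_embed_def row_retract_def block_embed_def)
next
  case True
  then show ?thesis
  proof (cases rule: mersenne_cases)
    case 1
    then show ?thesis using pad True by (simp add: row_embed_def block_embed_def)
  next
    case (2 k)
    consider "i < n div 2" | "n div 2 \<le> i" "i < n" | "n \<le> i" "n div 2 \<le> i" by linarith
    then show ?thesis
    proof cases
      case 1
      moreover have "Suc (2 * (n div 2)) = n" using 2 mersenne_row_odd[of k] by simp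
      ultimately show ?thesis using True mersenne_half[OF True]
        by (simp add: row_embed_def row_retract_def block_embed_def del: div_mult_self1_is_m)
    next
      case 2
      then have "level i = k" using \<open>n = mersenne_row k\<close> level_eq_mersenne_row by simp
      then show ?thesis using 2 True \<open>n = mersenne_row k\<close>
          by (simp add: row_embed_def block_embed_def block_part_def)
    next
      case 3
      then show ?thesis using True pad by (simp add: row_embed_def block_embed_def)
    qed
  qed
qed

section \<open>The space \<open>B_{q,0}\<close> under the row operations\<close>

context summing_exponent
begin

lemma lq_sum_nonneg: "0 \<le> lq_sum D g"
  by (simp add: lq_sum_def sum_nonneg)

lemma lq_norm_le_iff:
  assumes "0 \<le> M"
  shows "lq_norm q n g \<le> M \<longleftrightarrow> lq_sum {..<n} g \<le> M powr q"
proof -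
  have eq: "lq_norm q n g = lq_sum {..<n} g powr (1 / q)" by (simp add: lq_norm_def lq_sum_def)
  have inv: "(x powr (1 / q)) powr q = x" "(x powr q) powr (1 / q) = x" if "0 \<le> x" for x :: real
    using that q_gt_1 by (simp_all add: powr_powr)
  show ?thesis
  proof
    assume "lq_norm q n g \<le> M"
    then have "(lq_sum {..<n} g powr (1 / q)) powr q \<le> M powr q"
      unfolding eq using q_gt_1 by (intro powr_mono2) auto
    then show "lq_sum {..<n} g \<le> M powr q" by (simp only: inv(1)[OF lq_sum_nonneg])
  next
    assume "lq_sum {..<n} g \<le> M powr q"
    then have "lq_sum {..<n} g powr (1 / q) \<le> (M powr q) powr (1 / q)"
      using q_gt_1 lq_sum_nonneg by (intro powr_mono2) auto
    then show "lq_norm q n g \<le> M" unfolding eq by (simp only: inv(2)[OF assms])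
  qed
qed

text \<open>Replaces the limit of norms by non-strict bounds on q-th powers, the form of all block
  estimates.\<close>

lemma mem_Bq0_iff:
  "v \<in> Bq0 q \<longleftrightarrow> (\<forall>n i. n \<le> i \<longrightarrow> v n i = 0) \<and> (\<forall>e>0. \<exists>N. \<forall>n\<ge>N. lq_sum {..<n} (v n) \<le> e powr q)"
proof -
  have "(\<lambda>n. lq_norm q n (v n)) \<longlonglongrightarrow> 0 \<longleftrightarrow> (\<forall>e>0. \<exists>N. \<forall>n\<ge>N. lq_norm q n (v n) \<le> e)"
  proof
    assume "(\<lambda>n. lq_norm q n (v n)) \<longlonglongrightarrow> 0"
    then show "\<forall>e>0. \<exists>N. \<forall>n\<ge>N. lq_norm q n (v n) \<le> e"
      unfolding lim_sequentially by (fastforce simp: dist_real_def)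
  next
    assume *: "\<forall>e>0. \<exists>N. \<forall>n\<ge>N. lq_norm q n (v n) \<le> e"
    show "(\<lambda>n. lq_norm q n (v n)) \<longlonglongrightarrow> 0"
      unfolding lim_sequentially
    proof (intro allI impI)
      fix r :: real assume r: "0 < r"
      then obtain N where "\<forall>n\<ge>N. lq_norm q n (v n) \<le> r / 2" using * half_gt_zero by blast
      moreover have "0 \<le> lq_norm q n (v n)" for n by (simp add: lq_norm_def)
      ultimately show "\<exists>no. \<forall>n\<ge>no. dist (lq_norm q n (v n)) 0 < r"
        using r by (intro exI[of _ N]) (auto simp: dist_real_def intro: le_less_trans)
    qed
  qed
  then show ?thesis unfolding Bq0_def by (simp add: lq_norm_le_iff)
qed

lemma Bq0_pad: "v \<in> Bq0 q \<Longrightarrow> n \<le> i \<Longrightarrow> v n i = 0"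
  by (simp add: Bq0_def)

lemma Bq0_norm_le:
  assumes "0 \<le> M" and "\<And>n. lq_sum {..<n} (v n) \<le> M powr q"
  shows "Bq0_norm q v \<le> M"
  unfolding Bq0_norm_def by (rule cSUP_least) (use assms in \<open>simp_all add: lq_norm_le_iff\<close>)

lemma lq_norm_le_Bq0_norm:
  assumes "v \<in> Bq0 q"
  shows "lq_norm q n (v n) \<le> Bq0_norm q v"
  unfolding Bq0_norm_def
proof (rule cSUP_upper)
  have "Bseq (\<lambda>n. lq_norm q n (v n))"
    using assms by (auto simp: Bq0_def intro!: convergent_imp_Bseq convergentI)
  then show "bdd_above (range (\<lambda>n. lq_norm q n (v n)))"
    by (rule Bseq_bdd_above)
qed simp

lemma Bq0_norm_nonneg: "v \<in> Bq0 q \<Longrightarrow> 0 \<le> Bq0_norm q v"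
  using lq_norm_le_Bq0_norm[of v 0] by (simp add: lq_norm_def)

lemma lq_sum_le_Bq0_norm:
  assumes "v \<in> Bq0 q" and "Bq0_norm q v \<le> M"
  shows "lq_sum {..<n} (v n) \<le> M powr q"
  using lq_norm_le_Bq0_norm[OF assms(1), of n] Bq0_norm_nonneg[OF assms(1)] assms(2)
    lq_norm_le_iff[of M n "v n"] by linarith

text \<open>Row \<open>n\<close> of \<open>w\<close> is controlled by row \<open>h n\<close> of
  \<open>v\<close>; \<open>n div 2 \<le> h n\<close> forces \<open>h n\<close> to infinity, so the
  row norms of \<open>w\<close> tend to 0 as well.\<close>

lemma Bq0_dominated:
  assumes v: "v \<in> Bq0 q" and pad: "\<And>n i. n \<le> i \<Longrightarrow> w n i = 0"
    and dom: "\<And>n. n div 2 \<le> h n \<and> lq_sum {..<n} (w n) \<le> lq_sum {..<h n} (v (h n))"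
  shows "w \<in> Bq0 q" and "Bq0_norm q w \<le> Bq0_norm q v"
proof -
  show "w \<in> Bq0 q" unfolding mem_Bq0_iff
  proof (intro conjI allI impI)
    fix e :: real assume "0 < e"
    then obtain N where N: "\<And>n. n \<ge> N \<Longrightarrow> lq_sum {..<n} (v n) \<le> e powr q"
      using v unfolding mem_Bq0_iff by blast
    have "lq_sum {..<n} (w n) \<le> e powr q" if "2 * N \<le> n" for n
      using dom[of n] N[of "h n"] that by linarith
    then show "\<exists>N. \<forall>n\<ge>N. lq_sum {..<n} (w n) \<le> e powr q" by blast
  qed (rule pad)
  show "Bq0_norm q w \<le> Bq0_norm q v"
    using dom lq_sum_le_Bq0_norm[OF v order_refl]
    by (intro Bq0_norm_le Bq0_norm_nonneg v) (use order_trans in blast)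
qed

lemma Bq0_row_embed:
  assumes "v \<in> Bq0 q"
  shows "row_embed v \<in> Bq0 q" and "Bq0_norm q (row_embed v) \<le> Bq0_norm q v"
proof -
  define h where "h n = (if mersenne n then n div 2 else n)" for n
  have pad: "row_embed v n i = 0" if "n \<le> i" for n i
    using that Bq0_pad[OF assms] by (auto simp: row_embed_def)
  have dom: "n div 2 \<le> h n \<and> lq_sum {..<n} (row_embed v n) \<le> lq_sum {..<h n} (v (h n))" for n
  proof (cases "mersenne n")
    case True
    have "lq_sum {..<n} (row_embed v n) = lq_sum {..<n div 2} (v (n div 2))"
      unfolding lq_sum_def by (rule sum.mono_neutral_cong_right) (use True q_gt_1 in \<open>auto simp:
          row_embed_def\<close>)
    then show ?thesis using True by (simp add: h_def)
  next
    case False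
    then show ?thesis by (simp add: h_def row_embed_def lq_sum_def)
  qed
  show "row_embed v \<in> Bq0 q" and "Bq0_norm q (row_embed v) \<le> Bq0_norm q v"
    by (rule Bq0_dominated[OF assms pad dom]; assumption)+
qed

lemma Bq0_row_retract:
  assumes "v \<in> Bq0 q"
  shows "row_retract v \<in> Bq0 q" and "Bq0_norm q (row_retract v) \<le> Bq0_norm q v"
proof -
  define h where "h n = (if mersenne n then Suc (2 * n) else n)" for n
  have pad: "row_retract v n i = 0" if "n \<le> i" for n i
    using that Bq0_pad[OF assms] by (auto simp: row_retract_def)
  have dom: "n div 2 \<le> h n \<and> lq_sum {..<n} (row_retract v n) \<le> lq_sum {..<h n} (v (h n))" for n
  proof (cases "mersenne n")
    case True
    have "lq_sum {..<n} (row_retract v n) = lq_sum {..<n} (v (Suc (2 * n)))"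
      unfolding lq_sum_def by (rule sum.cong) (use True in \<open>auto simp: row_retract_def\<close>)
    then show ?thesis
      using True lq_sum_subset[of "{..<Suc (2 * n)}" "{..<n}" "v (Suc (2 * n))"] by (simp add: h_def)
  next
    case False
    then show ?thesis by (simp add: h_def row_retract_def lq_sum_def)
  qed
  show "row_retract v \<in> Bq0 q" and "Bq0_norm q (row_retract v) \<le> Bq0_norm q v"
    by (rule Bq0_dominated[OF assms pad dom]; assumption)+
qed

text \<open>The \<open>c_0\<close>-sum that carries the new system, each element written as one
  function of a single index whose blocks are the levels.\<close>

definition null_levels :: "(nat \<Rightarrow> 'k::real_normed_field) set" where
  "null_levels = {g. \<forall>e>0. \<exists>K. \<forall>k\<ge>K. lq_sum {i. level i = k} g \<le> e powr q}"

lemma lq_sum_block_embed_mersenne_row: "lq_sum {..<mersenne_row k} (block_embed g (mersenne_row k))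
    = lq_sum {i. level i = k} g"
  unfolding lq_sum_def
  by (rule sum.mono_neutral_cong_right) (use q_gt_1 in \<open>auto simp: block_embed_def
      mersenne_mersenne_row level_eq_mersenne_row\<close>)

lemma lq_sum_block_embed_le:
  assumes "\<And>k. n \<le> mersenne_row k \<Longrightarrow> lq_sum {i. level i = k} g \<le> M"  and "0 \<le> M"
  shows "lq_sum {..<n} (block_embed g n) \<le> M"
proof (cases "mersenne n")
  case True
  then show ?thesis
  proof (cases rule: mersenne_cases)
    case 1
    then show ?thesis using assms(2) by (simp add: lq_sum_def)
  next
    case (2 k)
    then show ?thesis using assms(1)[of k] by (simp add: lq_sum_block_embed_mersenne_row)
  qed
next
  case False
  then have "lq_sum {..<n} (block_embed g n) = 0" using q_gt_1 by (simp add: lq_sum_def block_embed_def)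
  then show ?thesis using assms(2) by simp
qed

lemma Bq0_block_embed:
  assumes "g \<in> null_levels"
  shows "block_embed g \<in> Bq0 q"
  unfolding mem_Bq0_iff
proof (intro conjI allI impI)
  fix e :: real assume "0 < e"
  then obtain K where K: "\<And>k. k \<ge> K \<Longrightarrow> lq_sum {i. level i = k} g \<le> e powr q"
    using assms unfolding null_levels_def by blast
  have "lq_sum {..<n} (block_embed g n) \<le> e powr q" if "mersenne_row K \<le> n" for n
  proof (rule lq_sum_block_embed_le)
    fix k assume "n \<le> mersenne_row k"
    then have "Suc (mersenne_row K) \<le> Suc (mersenne_row k)" using that by simp
    then have "(2::nat) ^ Suc K \<le> 2 ^ Suc k" by (simp only: Suc_mersenne_row)
    then have "K \<le> k" by simp
    then show "lq_sum {i. level i = k} g \<le> e powr q" by (rule K)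
  qed simp
  then show "\<exists>N. \<forall>n\<ge>N. lq_sum {..<n} (block_embed g n) \<le> e powr q" by blast
qed (simp add: block_embed_def)

lemma Bq0_norm_block_embed_le:
  assumes "\<And>k. lq_sum {i. level i = k} g \<le> M powr q" and "0 \<le> M"
  shows "Bq0_norm q (block_embed g) \<le> M"
  by (intro Bq0_norm_le lq_sum_block_embed_le assms) simp

lemma lq_sum_block_part_le: "lq_sum {i. level i = k} (block_part v)
    \<le> lq_sum {..<mersenne_row k} (v (mersenne_row k))"
proof -
  have "lq_sum {i. level i = k} (block_part v) = lq_sum {i. level i = k} (v (mersenne_row k))"
    unfolding lq_sum_def by (rule sum.cong) (auto simp: block_part_def)
  also have "\<dots> \<le> lq_sum {..<mersenne_row k} (v (mersenne_row k))"
    by (rule lq_sum_subset) (auto simp: level_eq_mersenne_row)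
  finally show ?thesis .
qed

lemma block_part_null_levels:
  assumes "v \<in> Bq0 q"
  shows "block_part v \<in> null_levels"
  unfolding null_levels_def
proof (intro CollectI allI impI)
  fix e :: real assume "0 < e"
  then obtain N where N: "\<And>n. n \<ge> N \<Longrightarrow> lq_sum {..<n} (v n) \<le> e powr q"
    using assms unfolding mem_Bq0_iff by blast
  have "lq_sum {i. level i = k} (block_part v) \<le> e powr q" if "N \<le> k" for k
  proof -
    have "k < 2 ^ Suc k" using less_exp[of "Suc k"] by simp
    then have "N \<le> mersenne_row k" using that by (simp add: mersenne_row_def)
    then show ?thesis using N lq_sum_block_part_le order_trans by blast
  qed
  then show "\<exists>K. \<forall>k\<ge>K. lq_sum {i. level i = k} (block_part v) \<le> e powr q" by blast
qed

lemma lq_sum_block_part_le_Bq0_norm: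
  assumes "v \<in> Bq0 q" and "Bq0_norm q v \<le> M"
  shows "lq_sum {i. level i = k} (block_part v) \<le> M powr q"
  using lq_sum_block_part_le lq_sum_le_Bq0_norm[OF assms] order_trans by blast

lemma Bq0_add:
  assumes "v \<in> Bq0 q" and "w \<in> Bq0 q"
  shows "(\<lambda>n i. v n i + w n i) \<in> Bq0 q"
  unfolding mem_Bq0_iff
proof (intro conjI allI impI)
  fix e :: real assume "0 < e"
  then have e: "0 < e / 4" by simp
  obtain N where N: "\<And>n. n \<ge> N \<Longrightarrow> lq_sum {..<n} (v n) \<le> (e / 4) powr q"
    using assms(1) e unfolding mem_Bq0_iff by blast
  obtain N' where N': "\<And>n. n \<ge> N' \<Longrightarrow> lq_sum {..<n} (w n) \<le> (e / 4) powr q"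
    using assms(2) e unfolding mem_Bq0_iff by blast
  have "lq_sum {..<n} (\<lambda>i. v n i + w n i) \<le> (2 * (e / 4 + e / 4)) powr q" if "max N N' \<le> n" for n
    by (rule lq_sum_add) (use N N' that e in auto)
  then show "\<exists>N. \<forall>n\<ge>N. lq_sum {..<n} (\<lambda>i. v n i + w n i) \<le> e powr q"
    by (intro exI[of _ "max N N'"]) simp
qed (simp add: Bq0_pad[OF assms(1)] Bq0_pad[OF assms(2)])

lemma Bq0_scale:
  assumes "v \<in> Bq0 q"
  shows "(\<lambda>n i. c * v n i) \<in> Bq0 q"
  unfolding mem_Bq0_iff
proof (intro conjI allI impI)
  fix e :: real assume e: "0 < e"
  define d where "d = norm c + 1"
  have d: "0 < d" "norm c \<le> d" by (simp_all add: d_def add_nonneg_pos)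
  then have "0 < e / d" using e by simp
  then obtain N where N: "\<And>n. n \<ge> N \<Longrightarrow> lq_sum {..<n} (v n) \<le> (e / d) powr q"
    using assms unfolding mem_Bq0_iff by blast
  have "lq_sum {..<n} (\<lambda>i. c * v n i) \<le> (d * (e / d)) powr q" if "N \<le> n" for n
    by (rule lq_sum_mono_dom[OF _ _ _ N[OF that]])
      (use d e in \<open>auto simp: norm_mult intro: mult_right_mono\<close>)
  then show "\<exists>N. \<forall>n\<ge>N. lq_sum {..<n} (\<lambda>i. c * v n i) \<le> e powr q" using d by auto
qed (simp add: Bq0_pad[OF assms])

text \<open>Inherited from \<open>Bq0\<close>: embed by \<open>block_embed\<close>, add there, and
  return by \<open>block_part\<close>.\<close>

lemma null_levels_add:
  assumes "g \<in> null_levels" and "h \<in> null_levels"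
  shows "(\<lambda>i. g i + h i) \<in> null_levels"
  using block_part_null_levels[OF Bq0_add[OF Bq0_block_embed[OF assms(1)] Bq0_block_embed[OF assms(2)]]]
  by (simp add: block_part_add block_part_block_embed)

lemma null_levels_scale:
  assumes "g \<in> null_levels"
  shows "(\<lambda>i. c * g i) \<in> null_levels"
  using block_part_null_levels[OF Bq0_scale[OF Bq0_block_embed[OF assms]]]
  by (simp add: block_part_scale block_part_block_embed)

lemma null_levels_sum_vec: "(sum_vec j :: nat \<Rightarrow> 'k::real_normed_field) \<in> null_levels"
  unfolding null_levels_def
proof (intro CollectI allI impI)
  fix e :: real
  have "lq_sum {i. level i = k} (sum_vec j :: nat \<Rightarrow> 'k) \<le> e powr q" if "Suc (level j) \<le> k" for k
  proof -
    have "lq_sum {i. level i = k} (sum_vec j :: nat \<Rightarrow> 'k) = (\<Sum>i | level i = k. 0)"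
      unfolding lq_sum_def by (rule sum.cong) (use that q_gt_1 in \<open>auto simp: sum_vec_def\<close>)
    then show ?thesis by simp
  qed
  then show "\<exists>K. \<forall>k\<ge>K. lq_sum {i. level i = k} (sum_vec j :: nat \<Rightarrow> 'k) \<le> e powr q" by blast
qed

lemma null_levels_synth:
  assumes "finite A"
  shows "synth A f \<in> null_levels"
  using assms
proof (induction A)
  case empty
  show ?case using q_gt_1 by (simp add: null_levels_def synth_def lq_sum_def)
next
  case (insert j A)
  have "synth (insert j A) f = (\<lambda>i. f j * sum_vec j i + synth A f i)"
    using insert by (simp add: synth_def fun_eq_iff)
  then show ?case using null_levels_add[OF null_levels_scale[OF null_levels_sum_vec] insert.IH] by simp
qed

end

section \<open>The new basis\<close>

text \<open>\<open>Ti\<close> is the inverse of \<open>T\<close> after the projection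
  \<open>P\<close>. Being defined on the whole space, it gives every vector its rows without
  restricting to the subspace.\<close>

locale complemented_Bq0 = banach_space_over scal + summing_exponent q
  for scal :: "'k::{real_normed_field,euclidean_space} \<Rightarrow> 'a::banach \<Rightarrow> 'a" and q :: real +
  fixes P :: "'a \<Rightarrow> 'a" and T :: "(nat \<Rightarrow> nat \<Rightarrow> 'k) \<Rightarrow> 'a" and Ti :: "'a \<Rightarrow> nat \<Rightarrow> nat \<Rightarrow> 'k"
    and c0 C0 :: real
  assumes P_lin: "bounded_linear P" and P_scal: "P (scal c x) = scal c (P x)"
    and P_T: "v \<in> Bq0 q \<Longrightarrow> P (T v) = T v"
    and Ti_mem: "Ti x \<in> Bq0 q" and T_Ti: "T (Ti x) = P x" and Ti_T: "v \<in> Bq0 q \<Longrightarrow> Ti (T v) = v"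
    and T_add: "v \<in> Bq0 q \<Longrightarrow> w \<in> Bq0 q \<Longrightarrow> T (\<lambda>n i. v n i + w n i) = T v + T w"
    and T_scal: "v \<in> Bq0 q \<Longrightarrow> T (\<lambda>n i. c * v n i) = scal c (T v)"
    and T_lower: "v \<in> Bq0 q \<Longrightarrow> c0 * Bq0_norm q v \<le> norm (T v)"
    and T_upper: "v \<in> Bq0 q \<Longrightarrow> norm (T v) \<le> C0 * Bq0_norm q v"
    and c0_pos: "0 < c0" and C0_pos: "0 < C0"
begin

lemma zero_mem: "(\<lambda>n i. 0 :: 'k) \<in> Bq0 q"
  using Bq0_scale[OF Ti_mem, of 0] by simp

lemma T_zero: "T (\<lambda>n i. 0) = 0"
  using T_scal[OF zero_mem, of 0] by simp

lemma Ti_eqI: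
  assumes "v \<in> Bq0 q" and "P x = T v"
  shows "Ti x = v"
proof -
  have "Ti x = Ti (T (Ti x))" by (rule Ti_T[OF Ti_mem, symmetric])
  also have "T (Ti x) = T v" unfolding T_Ti by (rule assms(2))
  also have "Ti (T v) = v" by (rule Ti_T[OF assms(1)])
  finally show ?thesis .
qed

lemma Ti_add: "Ti (x + y) = (\<lambda>n i. Ti x n i + Ti y n i)"
  by (intro Ti_eqI Bq0_add Ti_mem)
    (simp add: T_add Ti_mem T_Ti linear_add[OF bounded_linear.linear[OF P_lin]])

lemma Ti_scal: "Ti (scal c x) = (\<lambda>n i. c * Ti x n i)"
  by (intro Ti_eqI Bq0_scale Ti_mem) (simp add: T_scal Ti_mem T_Ti P_scal)

lemma ex_Ti_bound: "\<exists>K. 0 < K \<and> (\<forall>x. Bq0_norm q (Ti x) \<le> K * norm x)"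
proof -
  obtain KP where KP: "0 < KP" "\<And>x. norm (P x) \<le> norm x * KP"
    using bounded_linear.pos_bounded[OF P_lin] by blast
  have "Bq0_norm q (Ti x) \<le> KP / c0 * norm x" for x
  proof -
    have "c0 * Bq0_norm q (Ti x) \<le> norm x * KP"
      using T_lower[OF Ti_mem[of x]] KP(2)[of x] by (simp add: T_Ti)
    then show ?thesis using c0_pos by (simp add: field_simps)
  qed
  then show ?thesis using KP(1) c0_pos by (intro exI[of _ "KP / c0"]) auto
qed

definition KT :: real where "KT = (SOME K. 0 < K \<and> (\<forall>x. Bq0_norm q (Ti x) \<le> K * norm x))"

lemma KT: "0 < KT" "Bq0_norm q (Ti x) \<le> KT * norm x"
  using someI_ex[OF ex_Ti_bound] by (simp_all add: KT_def)

text \<open>\<open>U\<close> is an isomorphism onto a complemented subspace, with left inverse \<open>V\<close>; the complement is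
  the range of \<open>E\<close>, whose inverse is \<open>W\<close>.\<close>

definition U :: "'a \<Rightarrow> 'a" where "U x = (x - P x) + T (row_embed (Ti x))"
definition V :: "'a \<Rightarrow> 'a" where "V x = (x - P x) + T (row_retract (Ti x))"
definition E :: "(nat \<Rightarrow> 'k) \<Rightarrow> 'a" where "E g = T (block_embed g)"
definition W :: "'a \<Rightarrow> nat \<Rightarrow> 'k" where "W x = block_part (Ti x)"

lemma P_P: "P (P x) = P x"
  using P_T[OF Ti_mem[of x]] by (simp add: T_Ti)

lemma P_split: "v \<in> Bq0 q \<Longrightarrow> P ((x - P x) + T v) = T v"
  by (simp add: linear_diff[OF bounded_linear.linear[OF P_lin]]
      linear_add[OF bounded_linear.linear[OF P_lin]] P_P P_T)

lemma Ti_split: "v \<in> Bq0 q \<Longrightarrow> Ti ((x - P x) + T v) = v"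
  by (intro Ti_eqI P_split)

text \<open>Covers \<open>U\<close> and \<open>V\<close> at once: the operator is the identity on
  the kernel of \<open>P\<close> and acts as \<open>F\<close> on the copy of
  \<open>Bq0\<close>.\<close>

lemma bounded_linear_split:
  assumes add: "\<And>v w. F (\<lambda>n i. v n i + w n i) = (\<lambda>n i. F v n i + F w n i)"
    and scale: "\<And>c v. F (\<lambda>n i. c * v n i) = (\<lambda>n i. c * F v n i)"
    and mem: "\<And>v. v \<in> Bq0 q \<Longrightarrow> F v \<in> Bq0 q"
    and bound: "\<And>v. v \<in> Bq0 q \<Longrightarrow> Bq0_norm q (F v) \<le> Bq0_norm q v"
  shows "bounded_linear (\<lambda>x. (x - P x) + T (F (Ti x)))"
    and "(scal c x - P (scal c x)) + T (F (Ti (scal c x))) = scal c ((x - P x) + T (F (Ti x)))"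
proof -
  have sc: "(scal c x - P (scal c x)) + T (F (Ti (scal c x))) = scal c ((x - P x)
      + T (F (Ti x)))" for c x
    by (simp add: P_scal Ti_scal scale T_scal[OF mem[OF Ti_mem]] scale_right_distrib
        scale_right_diff_distrib)
  then show "(scal c x - P (scal c x)) + T (F (Ti (scal c x))) = scal c ((x - P x) + T (F (Ti x)))" .
  obtain KP where KP: "0 < KP" "\<And>x. norm (P x) \<le> norm x * KP"
    using bounded_linear.pos_bounded[OF P_lin] by blast
  show "bounded_linear (\<lambda>x. (x - P x) + T (F (Ti x)))"
  proof (rule bounded_linear_intro)
    show "(x + y - P (x + y)) + T (F (Ti (x + y))) = ((x - P x) + T (F (Ti x))) + ((y - P y)
        + T (F (Ti y)))" for x y
      by (simp add: linear_add[OF bounded_linear.linear[OF P_lin]] Ti_add add T_add[OF mem[OF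
          Ti_mem] mem[OF Ti_mem]])
    show "(r *\<^sub>R x - P (r *\<^sub>R x)) + T (F (Ti (r *\<^sub>R x))) = r *\<^sub>R ((x - P x) + T (F (Ti x)))" for r x
      using sc[of "of_real r" x] by (simp add: scale_of_real)
    show "norm ((x - P x) + T (F (Ti x))) \<le> norm x * (1 + KP + C0 * KT)" for x
    proof -
      have "Bq0_norm q (F (Ti x)) \<le> KT * norm x"
        using bound[OF Ti_mem[of x]] KT(2)[of x] by linarith
      then have "C0 * Bq0_norm q (F (Ti x)) \<le> C0 * (KT * norm x)"
        using C0_pos by simp
      then have "norm (T (F (Ti x))) \<le> C0 * (KT * norm x)"
        using T_upper[OF mem[OF Ti_mem[of x]]] by (rule order_trans[rotated])
      moreover have "norm (x - P x) \<le> norm x + norm x * KP"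
        using norm_triangle_ineq4[of x "P x"] KP(2)[of x] by linarith
      ultimately show ?thesis
        using norm_triangle_ineq[of "x - P x" "T (F (Ti x))"] by (simp add: algebra_simps)
    qed
  qed
qed

lemma U_lin: "bounded_linear U" and U_scal: "U (scal c x) = scal c (U x)"
  unfolding U_def[abs_def]
  by (rule bounded_linear_split[of row_embed]; use Bq0_row_embed in \<open>force simp: row_embed_def
      fun_eq_iff\<close>)+

lemma V_lin: "bounded_linear V" and V_scal: "V (scal c x) = scal c (V x)"
  unfolding V_def[abs_def]
  by (rule bounded_linear_split[of row_retract]; use Bq0_row_retract in \<open>force simp:
      row_retract_def fun_eq_iff\<close>)+

lemma Ti_U: "Ti (U x) = row_embed (Ti x)"
  unfolding U_def by (intro Ti_split Bq0_row_embed Ti_mem)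

lemma Ti_V: "Ti (V x) = row_retract (Ti x)"
  unfolding V_def by (intro Ti_split Bq0_row_retract Ti_mem)

lemma split_minus_P: "v \<in> Bq0 q \<Longrightarrow> ((x - P x) + T v) - P ((x - P x) + T v) = x - P x"
  by (simp add: P_split)

lemma V_U: "V (U x) = x"
proof -
  have "U x - P (U x) = x - P x" unfolding U_def by (rule split_minus_P[OF Bq0_row_embed(1)[OF Ti_mem]])
  then show ?thesis
    unfolding V_def[of "U x"] Ti_U by (simp add: row_retract_row_embed[OF Bq0_pad[OF Ti_mem]] T_Ti)
qed

lemma U_V_E: "U (V x) + E (W x) = x"
proof -
  have e: "V x - P (V x) = x - P x" unfolding V_def
      by (rule split_minus_P[OF Bq0_row_retract(1)[OF Ti_mem]])
  have "T (row_embed (row_retract (Ti x))) + T (block_embed (block_part (Ti x)))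
      = T (\<lambda>n i. row_embed (row_retract (Ti x)) n i + block_embed (block_part (Ti x)) n i)"
    by (rule T_add[symmetric]) (intro Bq0_row_embed Bq0_row_retract Ti_mem Bq0_block_embed
        block_part_null_levels)+
  also have "(\<lambda>n i. row_embed (row_retract (Ti x)) n i + block_embed (block_part (Ti x)) n i) = Ti x"
    by (intro ext row_embed_row_retract_block_embed_block_part Bq0_pad[OF Ti_mem])
  finally show ?thesis
    unfolding U_def[of "V x"] e Ti_V E_def W_def by (simp add: T_Ti add.assoc)
qed

lemma V_E:
  assumes "g \<in> null_levels"
  shows "V (E g) = 0"
  unfolding V_def E_def
  by (simp add: P_T[OF Bq0_block_embed[OF assms]] Ti_T[OF Bq0_block_embed[OF assms]]
      row_retract_block_embed T_zero)

lemma W_E: "g \<in> null_levels \<Longrightarrow> W (E g) = g"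
  by (simp add: W_def E_def Ti_T Bq0_block_embed block_part_block_embed)

lemma W_U: "W (U x) = (\<lambda>j. 0)"
  by (simp add: W_def Ti_U block_part_row_embed)

lemma W_add: "W (x + y) = (\<lambda>i. W x i + W y i)" and W_scal: "W (scal c x) = (\<lambda>i. c * W x i)"
  by (simp_all add: W_def Ti_add Ti_scal block_part_add block_part_scale)

lemma W_mem: "W x \<in> null_levels"
  unfolding W_def by (rule block_part_null_levels[OF Ti_mem])

lemma lq_sum_W: "lq_sum {i. level i = k} (W x) \<le> (KT * norm x) powr q"
  unfolding W_def by (rule lq_sum_block_part_le_Bq0_norm[OF Ti_mem KT(2)])

lemma E_add: "g \<in> null_levels \<Longrightarrow> h \<in> null_levels \<Longrightarrow> E (\<lambda>i. g i + h i) = E g + E h"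
  unfolding E_def T_add[OF Bq0_block_embed Bq0_block_embed, symmetric]
  by (rule arg_cong[where f = T]) (auto simp: block_embed_def fun_eq_iff)

lemma E_scal: "g \<in> null_levels \<Longrightarrow> E (\<lambda>i. c * g i) = scal c (E g)"
  unfolding E_def T_scal[OF Bq0_block_embed, symmetric]
  by (rule arg_cong[where f = T]) (auto simp: block_embed_def fun_eq_iff)

lemma E_diff: 
  assumes "g \<in> null_levels" "h \<in> null_levels"
  shows "E (\<lambda>i. g i - h i) = E g - E h"
  using E_add[OF assms(1) null_levels_scale[OF assms(2), of "- 1"]] E_scal[OF assms(2), of "- 1"]
      by simp

lemma E_synth: "finite A \<Longrightarrow> E (synth A f) = (\<Sum>j\<in>A. scal (f j) (E (sum_vec j)))"
proof (induction A rule: finite_induct)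
  case empty
  have "E (\<lambda>i. 0 * sum_vec 0 i) = scal 0 (E (sum_vec 0))" by (rule E_scal[OF null_levels_sum_vec])
  then show ?case by (simp add: synth_def[abs_def])
next
  case (insert j A)
  have "synth (insert j A) f = (\<lambda>i. f j * sum_vec j i + synth A f i)"
    using insert by (simp add: synth_def fun_eq_iff)
  then show ?case
    using insert by (simp add: E_add null_levels_scale null_levels_sum_vec null_levels_synth E_scal)
qed

lemma norm_E_le:
  assumes "g \<in> null_levels" and "\<And>k. lq_sum {i. level i = k} g \<le> M powr q" and "0 \<le> M"
  shows "norm (E g) \<le> C0 * M"
  unfolding E_def
proof (rule order_trans[OF T_upper[OF Bq0_block_embed[OF assms(1)]]])
  show "C0 * Bq0_norm q (block_embed g) \<le> C0 * M"
    using C0_pos by (intro mult_left_mono Bq0_norm_block_embed_le assms(2,3)) simp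
qed

lemma norm_E_ge:
  assumes "g \<in> null_levels"
  shows "c0 * norm (g j) \<le> norm (E g)"
proof -
  have "norm (g j) \<le> Bq0_norm q (block_embed g)"
    using norm_le_of_lq_sum[of j g] lq_sum_block_part_le_Bq0_norm[OF Bq0_block_embed[OF assms]
        order_refl, of "level j"]
      Bq0_norm_nonneg[OF Bq0_block_embed[OF assms]] by (simp add: block_part_block_embed)
  then show ?thesis
    using T_lower[OF Bq0_block_embed[OF assms]] c0_pos mult_left_mono[of "norm (g j)" "Bq0_norm q
        (block_embed g)" c0]
    unfolding E_def by linarith
qed

lemma sum_coeff_sums:
  assumes g: "g \<in> null_levels"
  shows "(\<lambda>j. scal (sum_coeff g j) (E (sum_vec j))) sums E g"
  unfolding sums_def lim_sequentially
proof (intro allI impI)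
  fix r :: real assume r: "0 < r"
  \<comment> \<open>\<open>lq_sum_remainder\<close> costs 14 and \<open>norm_E_le\<close> costs
    \<open>C0\<close>, so the error becomes \<open>r / 2\<close>.\<close>
  define e where "e = r / (28 * C0)"
  have e: "0 < e" using r C0_pos by (simp add: e_def)
  then obtain K where K: "\<And>k. k \<ge> K \<Longrightarrow> lq_sum {i. level i = k} g \<le> e powr q"
    using g unfolding null_levels_def by blast
  have "dist (\<Sum>j<n. scal (sum_coeff g j) (E (sum_vec j))) (E g) < r" if n: "2 ^ K \<le> n" for n
  proof -
    have "level (2 ^ K - 1) = K" using level_eq_iff[of "2 ^ K - 1" K] by auto
    then have Kn: "K \<le> level n" using level_mono[of "2 ^ K - 1" n] n by simp
    let ?s = "synth {..<n} (sum_coeff g)"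
    have "norm (E (\<lambda>i. g i - ?s i)) \<le> C0 * (14 * e)"
    proof (rule norm_E_le)
      show "(\<lambda>i. g i - ?s i) \<in> null_levels"
        using null_levels_add[OF g null_levels_scale[OF null_levels_synth, of "{..<n}" "- 1"
            "sum_coeff g"]] by simp
      show "lq_sum {i. level i = k} (\<lambda>i. g i - ?s i) \<le> (14 * e) powr q" for k
        by (rule lq_sum_remainder[OF K e Kn])
    qed (use e in simp)
    also have "C0 * (14 * e) < r" using r C0_pos by (simp add: e_def)
    finally show ?thesis
      by (simp add: E_diff[OF g null_levels_synth] E_synth dist_norm norm_minus_commute)
  qed
  then show "\<exists>no. \<forall>n\<ge>no. dist (\<Sum>j<n. scal (sum_coeff g j) (E (sum_vec j))) (E g) < r" by blast
qed

lemma W_zero: "W 0 = (\<lambda>j. 0)"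
  using W_scal[of 0 0] by simp

lemma sum_coeff_add: "sum_coeff (\<lambda>i. g i + h i) j = sum_coeff g j + sum_coeff h j"
  by (simp add: sum_coeff_def avg_def sum.distrib algebra_simps add_divide_distrib)

lemma sum_coeff_scale: "sum_coeff (\<lambda>i. c * g i) j = c * sum_coeff g j"
  by (simp add: sum_coeff_def avg_def sum_distrib_left[symmetric] algebra_simps)

lemma KT_norm_pos: "x \<noteq> 0 \<Longrightarrow> 0 < KT * norm x"
  using KT(1) by simp

lemma norm_sum_coeff_W_le: "norm (sum_coeff (W x) j) \<le> 3 * (KT * norm x)"
proof (cases "x = 0")
  case True
  then show ?thesis using sum_coeff_scale[of 0 "\<lambda>i. 0" j] by (simp add: W_zero)
next
  case False
  show ?thesis by (rule norm_sum_coeff_le[OF lq_sum_W KT_norm_pos[OF False]])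
qed

lemma norm_greedy_E_le:
  assumes "finite A" and "\<And>j k. j \<notin> A \<Longrightarrow> k \<in> A \<Longrightarrow> norm (sum_coeff (W x) j) \<le> norm (sum_coeff (W x) k)"
  shows "norm (\<Sum>j\<in>A. scal (sum_coeff (W x) j) (E (sum_vec j))) \<le> C0 * (2 * (6
      + tail_const) * KT) * norm x"
proof (cases "x = 0")
  case True
  have "sum_coeff (W x) j = 0" for j using norm_sum_coeff_W_le[of x j] True by simp
  then show ?thesis using True by simp
next
  case False
  have "norm (E (synth A (sum_coeff (W x)))) \<le> C0 * (2 * (6 + tail_const) * (KT * norm x))"
    by (intro norm_E_le null_levels_synth assms(1) lq_sum_greedy[OF lq_sum_W KT_norm_pos[OF False]
        assms])
      (use KT(1) tail_const_nonneg in auto)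
  then show ?thesis by (simp add: E_synth[OF assms(1)] mult.assoc)
qed

text \<open>Strict alternation puts the vectors of the levels below \<open>n\<close> at indices
  below \<open>2 ^ Suc n\<close>, so their position is only doubled.\<close>

definition basis :: "(nat \<Rightarrow> 'a) \<Rightarrow> nat \<Rightarrow> 'a" where
  "basis b0 = interleave (\<lambda>j. U (b0 j)) (\<lambda>j. E (sum_vec j))"

definition bcoord :: "(nat \<Rightarrow> 'a) \<Rightarrow> nat \<Rightarrow> 'a \<Rightarrow> 'k" where
  "bcoord b0 n x = interleave (\<lambda>j. coord scal b0 j (V x)) (sum_coeff (W x)) n"

text \<open>A greedy sum of \<open>f\<close> splits into a greedy sum of \<open>V f\<close> for
  \<open>b0\<close>, transported by \<open>U\<close>, and one of \<open>W f\<close> for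
  \<open>sum_vec\<close>, transported by \<open>E\<close>.\<close>

lemma quasi_greedy_basis_basis:
  assumes b0: "quasi_greedy_basis scal b0"
  shows "quasi_greedy_basis scal (basis b0)"
proof -
  obtain C \<delta> B where C: "0 < C" and "0 < \<delta>" and sb: "schauder_basis scal b0"
    and B: "\<forall>j. \<delta> \<le> norm (b0 j) \<and> norm (b0 j) \<le> B" and gr: "finite_greedy_bound b0 C"
    by (rule quasi_greedyD[OF b0])
  obtain K where K: "0 < K" "\<And>n f. norm (coord scal b0 n f) \<le> K * norm f"
    by (rule quasi_greedy_coord_bounded[OF b0]) blast
  obtain KU where KU: "0 < KU" "\<And>x. norm (U x) \<le> norm x * KU"
    using bounded_linear.pos_bounded[OF U_lin] by blast
  obtain KV where KV: "0 < KV" "\<And>x. norm (V x) \<le> norm x * KV"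
    using bounded_linear.pos_bounded[OF V_lin] by blast
  have V_add: "V (x + y) = V x + V y" for x y
    by (rule linear_add[OF bounded_linear.linear[OF V_lin]])
  have B0: "0 \<le> B" using B norm_ge_zero order_trans by blast
  have c_b0: "coord scal b0 i (b0 j) = (if i = j then 1 else 0)" for i j
    using coord_finite_sum[OF sb, of "{j}" i "\<lambda>_. 1"] by simp
  have c_0: "coord scal b0 i 0 = 0" for i
    using K(2)[of i 0] by simp
  have sum_coeff_0: "sum_coeff (\<lambda>j. 0) i = (0 :: 'k)" for i
    using sum_coeff_scale[of 0 "\<lambda>i. 0" i] by simp
  have sumsE: "(\<lambda>n. scal (bcoord b0 n x) (basis b0 n)) sums x" for x
  proof -
    have "(\<lambda>j. U (scal (coord scal b0 j (V x)) (b0 j))) sums U (V x)"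
      by (rule bounded_linear.sums[OF U_lin coord_sums[OF sb]])
    then have "(\<lambda>j. scal (coord scal b0 j (V x)) (U (b0 j))) sums U (V x)"
      by (simp add: U_scal)
    from interleave_sums[OF this sum_coeff_sums[OF W_mem[of x]]] show ?thesis
      by (simp add: basis_def bcoord_def U_V_E)
  qed
  show ?thesis
  proof (rule quasi_greedy_basisI[where c = "bcoord b0"])
    show "bcoord b0 n (f + g) = bcoord b0 n f + bcoord b0 n g" for n f g
      by (simp add: bcoord_def interleave_def V_add coord_add[OF sb] W_add sum_coeff_add)
    show "bcoord b0 n (scal r f) = r * bcoord b0 n f" for n r f
      by (simp add: bcoord_def interleave_def V_scal coord_scal[OF sb] W_scal sum_coeff_scale)
    show "norm (bcoord b0 n f) \<le> (K * KV + 3 * KT) * norm f" for n f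
    proof -
      have "norm (coord scal b0 j (V f)) \<le> K * KV * norm f" for j
      proof -
        have "K * norm (V f) \<le> K * (norm f * KV)" using K(1) KV(2) by (intro mult_left_mono) auto
        then show ?thesis using K(2)[of j "V f"] by (simp add: mult_ac)
      qed
      moreover have "norm (sum_coeff (W f) j) \<le> 3 * KT * norm f" for j
        using norm_sum_coeff_W_le[of f j] by (simp add: mult.assoc)
      moreover have "0 \<le> 3 * KT * norm f" "0 \<le> K * KV * norm f" using KT(1) K(1) KV(1) by simp_all
      ultimately show ?thesis
        unfolding bcoord_def interleave_def distrib_right by (simp add: add_increasing add_increasing2)
    qed
    show "bcoord b0 n (basis b0 m) = (if n = m then 1 else 0)" for n m
    proof -
      have "n = m \<longleftrightarrow> n div 2 = m div 2 \<and> even n = even m" by (metis mult_div_mod_eq parity_cases)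
      then show ?thesis
        by (auto simp: bcoord_def basis_def interleave_def V_U V_E[OF null_levels_sum_vec] W_U
          W_E[OF null_levels_sum_vec] c_b0 c_0 sum_coeff_0 sum_coeff_sum_vec)
    qed
    show "(\<lambda>n. scal (bcoord b0 n f) (basis b0 n)) sums f" for f by (rule sumsE)
    show "norm (basis b0 n) \<le> B * KU + C0 * 1" for n
    proof -
      have "norm (U (b0 j)) \<le> B * KU" for j
        by (rule order_trans[OF KU(2)], rule mult_right_mono) (use B KU(1) in auto)
      moreover have "norm (E (sum_vec j)) \<le> C0 * 1" for j
        by (intro norm_E_le null_levels_sum_vec lq_sum_sum_vec) simp
      moreover have "0 \<le> B * KU" using B0 KU(1) by simp
      ultimately show ?thesis using C0_pos by (simp add: basis_def interleave_def add_increasing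
          add_increasing2)
    qed
    show "norm (\<Sum>n\<in>A. scal (bcoord b0 n f) (basis b0 n)) \<le> (KU * (1 + C) * KV + C0 * (2 * (6
        + tail_const) * KT)) * norm f"
      if "finite A" "\<And>j k. j \<notin> A \<Longrightarrow> k \<in> A \<Longrightarrow> norm (bcoord b0 j f) \<le> norm (bcoord b0 k f)" for f A
    proof -
      have "norm (\<Sum>n\<in>A. scal (bcoord b0 n f) (basis b0 n)) \<le> KU * (1 + C) * KV * norm f
          + C0 * (2 * (6 + tail_const) * KT) * norm f"
        unfolding bcoord_def basis_def
      proof (rule interleave_greedy_bound[OF that(1)])
        show "norm (interleave (\<lambda>j. coord scal b0 j (V f)) (sum_coeff (W f)) j)
            \<le> norm (interleave (\<lambda>j. coord scal b0 j (V f)) (sum_coeff (W f)) k)"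
          if "j \<notin> A" "k \<in> A" for j k
          using \<open>\<And>j k. j \<notin> A \<Longrightarrow> k \<in> A \<Longrightarrow> norm (bcoord b0 j f) \<le> norm (bcoord b0 k f)\<close>[OF that]
          by (simp only: bcoord_def)
        fix A' :: "nat set"
        assume A': "finite A'"
        show "norm (\<Sum>j\<in>A'. scal (sum_coeff (W f) j) (E (sum_vec j))) \<le> C0 * (2 * (6
            + tail_const) * KT) * norm f"
          if "\<And>j k. j \<notin> A' \<Longrightarrow> k \<in> A' \<Longrightarrow> norm (sum_coeff (W f) j) \<le> norm (sum_coeff (W f) k)"
          by (rule norm_greedy_E_le[OF A' that])
        show "norm (\<Sum>j\<in>A'. scal (coord scal b0 j (V f)) (U (b0 j))) \<le> KU * (1 + C) * KV * norm f"
          if g: "\<And>j k. j \<notin> A' \<Longrightarrow> k \<in> A' \<Longrightarrow> norm (coord scal b0 j (V f)) \<le> norm (coord scal b0 k (V f))"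
        proof -
          let ?s = "\<Sum>j\<in>A'. scal (coord scal b0 j (V f)) (b0 j)"
          have "norm (V f - ?s) \<le> C * norm (V f)" by (rule finite_greedy_boundD[OF gr A' g])
          then have "norm ?s \<le> (1 + C) * norm (V f)"
            using norm_triangle_ineq4[of "V f" "V f - ?s"] by (simp add: algebra_simps)
          also have "\<dots> \<le> (1 + C) * (norm f * KV)" using KV(2) C by (intro mult_left_mono) auto
          finally have "norm ?s * KU \<le> (1 + C) * (norm f * KV) * KU"
            using KU(1) by (intro mult_right_mono) auto
          moreover have "(\<Sum>j\<in>A'. scal (coord scal b0 j (V f)) (U (b0 j))) = U ?s"
            by (simp add: linear_sum[OF bounded_linear.linear[OF U_lin]] U_scal)
          ultimately show ?thesis using KU(2)[of ?s] by (simp add: mult_ac)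
        qed
      qed
      then show ?thesis by (simp add: distrib_right)
    qed
  qed
qed

text \<open>The alternating vector has bounded norm, while its projection to the even levels has a
  coordinate of order \<open>n\<close>. \<open>bdd\<close> ensures that this one quotient lies below
  the real supremum.\<close>

lemma w_cond_const_basis_ge:
  assumes b0: "quasi_greedy_basis scal b0" and n: "0 < n" and m: "2 ^ Suc n \<le> m"
    and bdd: "bdd_above {norm (coord_proj scal (basis b0) A f) / norm f | f A. f \<noteq> 0
        \<and> supp scal (basis b0) f \<subseteq> {..<m}}"
  shows "c0 / (4 * C0) * real n \<le> w_cond_const scal (basis b0) m"
proof -
  have sb: "schauder_basis scal (basis b0)"
    using quasi_greedy_basis_basis[OF b0] by (simp add: quasi_greedy_basis_def)
  have odd_sum: "(\<Sum>i\<in>(\<lambda>j. Suc (2 * j)) ` A. scal (alternating (i div 2)) (basis b0 i))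
      = E (synth A alternating)"
    if "finite A" for A
    by (subst sum.reindex) (auto simp: inj_on_def E_synth[OF that] basis_def interleave_def)
  define D where "D = {j. level j < n}"
  define D' where "D' = {j. level j < n \<and> even (level j)}"
  have fin: "finite D" "finite D'" unfolding D_def D'_def
    by (simp, rule finite_subset[OF _ finite_level_less[of n]]) auto
  define f where "f = E (synth D alternating)"
  define A where "A = (\<lambda>j. Suc (2 * j)) ` D'"
  have f_eq: "f = (\<Sum>i\<in>(\<lambda>j. Suc (2 * j)) ` D. scal (alternating (i div 2)) (basis b0 i))"
    unfolding f_def by (rule odd_sum[OF fin(1), symmetric])
  have coord_f: "coord scal (basis b0) i f = (if i \<in> (\<lambda>j. Suc (2 * j)) ` D then alternating (i div
      2) else 0)" for i
    unfolding f_eq by (rule coord_finite_sum[OF sb]) (simp add: fin)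
  have "supp scal (basis b0) f \<subseteq> (\<lambda>j. Suc (2 * j)) ` D"
    by (auto simp: supp_def coord_f split: if_splits)
  also have "\<dots> \<subseteq> {..<m}"
  proof -
    have "Suc (2 * j) < m" if "level j < n" for j
    proof -
      have "Suc j < 2 ^ Suc (level j)" using level_eq_iff[of j "level j"] by simp
      also have "\<dots> \<le> 2 ^ n" using that by (intro power_increasing) auto
      finally show ?thesis using m by simp
    qed
    then show ?thesis by (auto simp: D_def)
  qed
  finally have supp_f: "supp scal (basis b0) f \<subseteq> {..<m}" .
  \<comment> \<open>Index 1 is the first odd position and carries the coefficient
    \<open>alternating 0\<close>, which is 1; \<open>0 < n\<close> puts index 0 into
    \<open>D\<close>.\<close>
  have "coord scal (basis b0) (Suc 0) f = 1"
    using n by (auto simp: coord_f D_def alternating_def image_iff)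
  moreover have "coord scal (basis b0) (Suc 0) 0 = 0"
    using coord_finite_sum[OF sb, of "{}"] by simp
  ultimately have f0: "f \<noteq> 0" by auto
  have nf: "norm f \<le> C0 * 2"
    unfolding f_def D_def by (intro norm_E_le lq_sum_synth_alternating null_levels_synth) auto
  have "coord_proj scal (basis b0) A f = (\<Sum>i\<in>A. scal (alternating (i div 2)) (basis b0 i))"
    unfolding A_def by (subst coord_proj_finite) (use fin in \<open>auto simp: coord_f D_def D'_def
        intro!: sum.cong\<close>)
  also have "\<dots> = E (synth D' alternating)" unfolding A_def by (rule odd_sum[OF fin(2)])
  finally have "c0 * norm (synth D' alternating 0 :: 'k) \<le> norm (coord_proj scal (basis b0) A f)"
    using norm_E_ge[OF null_levels_synth[OF fin(2)], where j = 0] by simp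
  moreover have "c0 * (real n / 2) \<le> c0 * norm (synth D' alternating 0 :: 'k)"
    unfolding D'_def by (intro mult_left_mono synth_alternating_even_0) (use c0_pos in simp)
  ultimately have "c0 * (real n / 2) \<le> norm (coord_proj scal (basis b0) A f)" by linarith
  \<comment> \<open>The numerator is at least \<open>c0 * n / 2\<close> and \<open>norm f\<close> at
    most \<open>2 * C0\<close>, whence the factor \<open>c0 / (4 * C0)\<close>.\<close>
  then have "c0 * (real n / 2) / (C0 * 2) \<le> norm (coord_proj scal (basis b0) A f) / norm f"
    using nf f0 c0_pos by (intro frac_le) auto
  also have "\<dots> \<le> w_cond_const scal (basis b0) m"
    unfolding w_cond_const_def by (rule cSup_upper[OF _ bdd]) (use f0 supp_f in blast)
  finally show ?thesis by simp
qed

end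

section \<open>Two-sided estimate of the conditionality constants\<close>

context banach_space_over
begin

lemma w_cond_set_bounded:
  assumes "0 < K"
    "\<And>m A f. 2 \<le> m \<Longrightarrow> supp scal b f \<subseteq> {..<m} \<Longrightarrow>
      norm (coord_proj scal b A f) \<le> K * ln (real m) * norm f" and "2 \<le> m"
    and x: "x \<in> {norm (coord_proj scal b A f) / norm f | f A. f \<noteq> 0 \<and> supp scal b f \<subseteq> {..<m}}"
  shows "x \<le> K * ln (real m)"
proof -
  obtain f A where "x = norm (coord_proj scal b A f) / norm f" "f \<noteq> 0" "supp scal b f \<subseteq> {..<m}"
    using x by blast
  then show ?thesis using assms(2)[of m f A] assms(3) by (simp add: divide_le_eq)
qed

text \<open>Makes the supremum meaningful and at least 1, which later absorbs additive constants
  into multiples of it.\<close>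

lemma one_mem_w_cond_set:
  assumes "schauder_basis scal b" and "b 0 \<noteq> 0" and "0 < m"
  shows "1 \<in> {norm (coord_proj scal b A f) / norm f | f A. f \<noteq> 0 \<and> supp scal b f \<subseteq> {..<m}}"
proof -
  have c: "coord scal b i (b 0) = (if i = 0 then 1 else 0)" for i
    using coord_finite_sum[OF assms(1), of "{0}" i "\<lambda>_. 1"] by simp
  have "coord_proj scal b {0} (b 0) = b 0" by (simp add: coord_proj_finite c)
  then have "1 = norm (coord_proj scal b {0} (b 0)) / norm (b 0)" using assms(2) by simp
  moreover have "supp scal b (b 0) \<subseteq> {..<m}" using assms(3) by (auto simp: supp_def c split: if_splits)
  ultimately show ?thesis using assms(2) by blast
qed

end

lemma (in complemented_Bq0) w_cond_const_basis_equivalent: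
  assumes b0: "quasi_greedy_basis scal b0"
  shows "equivalent_on {2..} (w_cond_const scal (basis b0)) (\<lambda>m. ln (real m))"
proof -
  let ?b = "basis b0"
  let ?S = "\<lambda>m. {norm (coord_proj scal ?b A f) / norm f | f A. f \<noteq> 0 \<and> supp scal ?b f \<subseteq> {..<m}}"
  have qg: "quasi_greedy_basis scal ?b" by (rule quasi_greedy_basis_basis[OF b0])
  then have sb: "schauder_basis scal ?b" by (simp add: quasi_greedy_basis_def)
  have "?b 0 \<noteq> 0"
    using quasi_greedyD[OF qg] by (metis norm_zero not_le)
  then have one: "1 \<in> ?S m" if "2 \<le> m" for m
    by (rule one_mem_w_cond_set[OF sb]) (use that in simp)
  obtain K where K: "0 < K" "\<And>m A f. 2 \<le> m \<Longrightarrow> supp scal ?b f \<subseteq> {..<m} \<Longrightarrow>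
      norm (coord_proj scal ?b A f) \<le> K * ln (real m) * norm f"
    by (rule quasi_greedy_proj_bound[OF qg]) blast
  have up: "x \<le> K * ln (real m)" if "2 \<le> m" "x \<in> ?S m" for m x
    by (rule w_cond_set_bounded[OF K that])
  have bdd: "bdd_above (?S m)" if "2 \<le> m" for m
    by (rule bdd_aboveI[of _ "K * ln (real m)"]) (rule up[OF that])
  have "w_cond_const scal ?b m \<le> K * ln (real m)" if "2 \<le> m" for m
    unfolding w_cond_const_def by (rule cSup_least) (use one[OF that] up[OF that] in blast)+
  then have 1: "dominated_on {2..} (w_cond_const scal ?b) (\<lambda>m. ln (real m))"
    unfolding dominated_on_def by auto
  define \<kappa> where "\<kappa> = c0 / (4 * C0)"
  have \<kappa>: "0 < \<kappa>" using c0_pos C0_pos by (simp add: \<kappa>_def)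
  \<comment> \<open>\<open>ln m\<close> is at most \<open>n + 2\<close>: the \<open>n\<close> costs
    \<open>1 / \<kappa>\<close>, and the 2 is covered because the supremum is at least 1.\<close>
  have "ln (real m) \<le> (1 / \<kappa> + 2) * w_cond_const scal ?b m" if m: "2 \<le> m" for m
  proof -
    let ?w = "w_cond_const scal ?b m"
    have w1: "1 \<le> ?w" unfolding w_cond_const_def by (rule cSup_upper[OF one[OF m] bdd[OF m]])
    obtain n' where n': "2 ^ n' \<le> m" "m < 2 ^ (n' + 1)"
      using ex_power_ivl1[of 2 m] m by auto
    \<comment> \<open>One dyadic step is given up, since the lower bound at \<open>n\<close>
      requires \<open>2 ^ Suc n \<le> m\<close>.\<close>
    obtain n where n: "n' = Suc n" using n' m by (cases n') auto
    have "real m \<le> 2 ^ (n + 2)" using of_nat_mono[of m "2 ^ (n + 2)", where 'a = real] n'(2) n by simp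
    then have "ln (real m) \<le> ln (2 ^ (n + 2))" using m by (subst ln_le_cancel_iff) simp_all
    also have "\<dots> = real (n + 2) * ln 2" by (rule ln_realpow)
    also have "\<dots> \<le> real (n + 2) * 1" using ln_2_less_1 by (intro mult_left_mono) auto
    finally have "ln (real m) \<le> real n + 2" by simp
    moreover have "real n \<le> 1 / \<kappa> * ?w"
    proof (cases "n = 0")
      case False
      then have "\<kappa> * real n \<le> ?w"
        unfolding \<kappa>_def by (intro w_cond_const_basis_ge[OF b0 _ _ bdd[OF m]]) (use n' n in auto)
      then show ?thesis using \<kappa> by (simp add: le_divide_eq mult.commute)
    qed (use \<kappa> w1 in simp)
    ultimately show ?thesis using w1 unfolding distrib_right by linarith
  qed
  then have 2: "dominated_on {2..} (\<lambda>m. ln (real m)) (w_cond_const scal ?b)"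
    unfolding dominated_on_def by auto
  show ?thesis using 1 2 by (simp add: equivalent_on_def)
qed

theorem theorem3p9:
  fixes scal :: "'k::{real_normed_field,euclidean_space} \<Rightarrow> 'a::banach \<Rightarrow> 'a"
    and q :: real
  assumes "banach_space_over scal"
    and "\<exists>b. quasi_greedy_basis scal b"
    and "1 < q"
    and "\<exists>Y. complemented_subspace scal Y \<and> Bq0_isomorphic scal q Y"
  shows "\<exists>b. quasi_greedy_basis scal b \<and>
           equivalent_on {2..} (w_cond_const scal b) (\<lambda>m. ln (real m))"
proof -
  obtain b0 where b0: "quasi_greedy_basis scal b0" using assms(2) by blast
  obtain Y where Y: "complemented_subspace scal Y" "Bq0_isomorphic scal q Y" using assms(4) by blast
  obtain P where P: "bounded_linear P" "\<And>c x. P (scal c x) = scal c (P x)" "range P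
      = Y" "\<And>y. y \<in> Y \<Longrightarrow> P y = y"
    using Y(1) unfolding complemented_subspace_def by blast
  obtain T :: "(nat \<Rightarrow> nat \<Rightarrow> 'k) \<Rightarrow> 'a" where T: "bij_betw T (Bq0 q) Y \<and>
        (\<forall>x\<in>Bq0 q. \<forall>y\<in>Bq0 q. T (\<lambda>n i. x n i + y n i) = T x + T y) \<and>
        (\<forall>c. \<forall>x\<in>Bq0 q. T (\<lambda>n i. c * x n i) = scal c (T x)) \<and>
        (\<exists>c>0. \<exists>C. \<forall>x\<in>Bq0 q. c * Bq0_norm q x \<le> norm (T x) \<and> norm (T x) \<le> C * Bq0_norm q x)"
    using Y(2) unfolding Bq0_isomorphic_def by (elim exE)
  then obtain c0 C where c0: "0 < c0"
    and bounds: "\<forall>x\<in>Bq0 q. c0 * Bq0_norm q x \<le> norm (T x) \<and> norm (T x) \<le> C * Bq0_norm q x"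
    by (elim conjE exE)
  have bij: "bij_betw T (Bq0 q) Y" using T by (rule conjunct1)
  have q: "summing_exponent q" using assms(3) by unfold_locales
  define Ti where "Ti x = inv_into (Bq0 q) T (P x)" for x
  have PY: "P x \<in> Y" for x using P(3) by blast
  have TY: "T v \<in> Y" if "v \<in> Bq0 q" for v using bij that bij_betwE by blast
  have img: "T ` Bq0 q = Y" and inj: "inj_on T (Bq0 q)" using bij by (auto simp: bij_betw_def)
  \<comment> \<open>The isomorphism provides \<open>C\<close> without a sign condition, whereas the
    locale asks for a positive constant; enlarging it is harmless because the norm on
    \<open>Bq0\<close> is nonnegative.\<close>
  have loc: "complemented_Bq0 scal q P T Ti c0 (max C 1)"
  proof (intro complemented_Bq0.intro complemented_Bq0_axioms.intro)
    show "banach_space_over scal" by (rule assms(1))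
    show "summing_exponent q" by (rule q)
    show "bounded_linear P" by (rule P(1))
    show "P (scal c x) = scal c (P x)" for c x by (rule P(2))
    show "P (T v) = T v" if "v \<in> Bq0 q" for v by (rule P(4)[OF TY[OF that]])
    show "Ti x \<in> Bq0 q" for x unfolding Ti_def by (rule inv_into_into) (simp add: img PY)
    show "T (Ti x) = P x" for x using f_inv_into_f[of "P x" T "Bq0 q"] by (simp add: Ti_def img PY)
    show "Ti (T v) = v" if "v \<in> Bq0 q" for v
      unfolding Ti_def P(4)[OF TY[OF that]] by (rule inv_into_f_f[OF inj that])
    show "norm (T v) \<le> max C 1 * Bq0_norm q v" if "v \<in> Bq0 q" for v
    proof -
      have "C * Bq0_norm q v \<le> max C 1 * Bq0_norm q v"
        using summing_exponent.Bq0_norm_nonneg[OF q that] by (intro mult_right_mono) auto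
      then show ?thesis using bspec[OF bounds that] by linarith
    qed
    show "T (\<lambda>n i. v n i + w n i) = T v + T w" if "v \<in> Bq0 q" "w \<in> Bq0 q" for v w
      using T that by simp
    show "T (\<lambda>n i. c * v n i) = scal c (T v)" if "v \<in> Bq0 q" for c v
      using T that by simp
    show "c0 * Bq0_norm q v \<le> norm (T v)" if "v \<in> Bq0 q" for v
      using bounds that by simp
  qed (use c0 in simp_all)
  show ?thesis
    using complemented_Bq0.quasi_greedy_basis_basis[OF loc b0]
      complemented_Bq0.w_cond_const_basis_equivalent[OF loc b0] by blast
qed

end
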